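(* Let $(G,c)$ be a transient network with reference vertex $o$, and let $J$ be the closure of the inclusion operator $\operatorname{span}\{\delta_x\}_{x\in G}\subseteq\ell^2(G)\to\mathcal H_{\mathcal E}$, $\delta_x\mapsto\delta_x$. The following are equivalent: (1) $\Delta_{\ell^2}:\ell^2(G)\to\ell^2(G)$ is bounded. (2) $\Delta_{\mathcal H_{\mathcal E}}:\mathcal H_{\mathcal E}\to\mathcal H_{\mathcal E}$ is bounded. (3) $J:\ell^2(G)\to\mathcal H_{\mathcal E}$ is bounded. Moreover, in this case $\|\Delta_{\ell^2}\|=\|\Delta_{\mathcal H_{\mathcal E}}\|=\|J\|^2$.
   Context: A network $(G,c)$ is a connected weighted undirected graph with vertex set $G$, given by a symmetric function $c:G\times G\to[0,\infty)$, $(x,y)\mapsto c_{xy}=c_{yx}$, with $c_{xx}=0$; write $x\sim y$ iff $c_{xy}>0$. It is locally finite (each $x$ has only finitely many $y$ with $y\sim x$) and connected (any two vertices are joined by a finite path of edges with positive conductance). A reference vertex $o\in G$ is fixed. The Laplacian acts on functions by $(\Delta u)(x)=\sum_{y\sim x}c_{xy}(u(x)-u(y))$; this is also well defined on functions modulo constants. The energy form is $\mathcal E(u,v)=\frac12\sum_{x,y\in G}c_{xy}(u(x)-u(y))(v(x)-v(y))$ on $\operatorname{dom}\mathcal E=\{u:G\to\mathbb R:\mathcal E(u,u)<\infty\}$. The energy space $\mathcal H_{\mathcal E}:=\operatorname{dom}\mathcal E/\mathbb R\mathbf 1$ (functions of finite energy modulo constants) is a Hilbert space with inner product $\langle u,v\rangle_{\mathcal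 H_{\mathcal E}}=\mathcal E(u,v)$ (in the complex-valued case $\mathcal E(\bar u,v)$). For $x\in G$, $v_x\in\mathcal H_{\mathcal E}$ is the unique element with $\langle v_x,u\rangle_{\mathcal H_{\mathcal E}}=u(x)-u(o)$ for all $u\in\mathcal H_{\mathcal E}$. A monopole at $x$ is a $w\in\mathcal H_{\mathcal E}$ with $\Delta w=\delta_x$ pointwise; monopoles exist iff the network is transient (the random walk with transition probabilities $c_{xy}/\sum_z c_{xz}$ is transient). Let $w_o$ be the unique monopole at $o$ of minimal energy, and $w_x:=w_o+v_x$ for $x\ne o$, so $\Delta w_x=\delta_x$. $\Delta_{\mathcal H_{\mathcal E}}$ is the closed operator on $\mathcal H_{\mathcal E}$ obtained as the graph closure of $\Delta$ on the dense domain $\operatorname{span}\{w_x\}_{x\in G}$ (finite linear combinations), where $\Delta u$ is regarded as an element of $\mathcal H_{\mathcal E}$. $\ell^2(G)$ is the space of square-summable functions on $G$ (counting measure), with $\langle u,v\rangle_{\ell^2}=\sum_x u(x)v(x)$ (conjugate on $u$ in the complex case). $\delta_x$ denotes both the characteristic function of $\{x\}$ in $\ell^2(G)$ and the element of $\mathcal H_{\mathcal E}$ it represents (it has finite energy). $\Delta_{\ell^2}$ is the graph closure in $\ell^2(G)$ of $\Delta$ on $\operatorname{span}\{\delta_x\}_{x\in G}$. The inclusion operator is densely defined and closable. Norms are operator norms. *)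

theory Defs
  imports "HOL-Analysis.Analysis"
begin

section \<open>Networks\<close>

text \<open>The vertex set \<open>G\<close> is the type \<^typ>\<open>'v\<close>; \<open>x \<sim> y\<close> is \<open>0 < c x y\<close>.\<close>

locale network =
  fixes c :: "'v \<Rightarrow> 'v \<Rightarrow> real"
  assumes conductance_nonneg: "0 \<le> c x y"
    and conductance_sym: "c x y = c y x"
    and no_loops: "c x x = 0"
    and locally_finite: "finite {y. 0 < c x y}"
    and network_connected: "(\<lambda>x y. 0 < c x y)\<^sup>*\<^sup>* x y"

definition laplacian :: "('v \<Rightarrow> 'v \<Rightarrow> real) \<Rightarrow> ('v \<Rightarrow> real) \<Rightarrow> 'v \<Rightarrow> real" where
  "laplacian c u x = (\<Sum>y | 0 < c x y. c x y * (u x - u y))"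

definition finite_energy :: "('v \<Rightarrow> 'v \<Rightarrow> real) \<Rightarrow> ('v \<Rightarrow> real) \<Rightarrow> bool" where
  "finite_energy c u \<longleftrightarrow> (\<lambda>(x, y). c x y * (u x - u y)\<^sup>2) summable_on UNIV"

definition energy :: "('v \<Rightarrow> 'v \<Rightarrow> real) \<Rightarrow> ('v \<Rightarrow> real) \<Rightarrow> ('v \<Rightarrow> real) \<Rightarrow> real" where
  "energy c u v = 1/2 * (\<Sum>\<^sub>\<infinity>(x, y)\<in>UNIV. c x y * (u x - u y) * (v x - v y))"


section \<open>Random walk and transience\<close>

text \<open>On a one-vertex network there are no edges to follow and the walk stays where it is;
  without this convention the one-vertex network would count as transient.\<close>

definition step_prob :: "('v \<Rightarrow> 'v \<Rightarrow> real) \<Rightarrow> 'v \<Rightarrow> 'v \<Rightarrow> real" where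
  "step_prob c x y =
     (let s = (\<Sum>z | 0 < c x z. c x z) in if s = 0 then of_bool (x = y) else c x y / s)"

text \<open>\<open>first_hit_prob c x n y\<close> is the probability that the walk started at \<open>y\<close> is at \<open>x\<close>
  at time \<open>n + 1\<close> and at none of the times \<open>1, \<dots>, n\<close>.\<close>

primrec first_hit_prob :: "('v \<Rightarrow> 'v \<Rightarrow> real) \<Rightarrow> 'v \<Rightarrow> nat \<Rightarrow> 'v \<Rightarrow> real" where
  "first_hit_prob c x 0 y = step_prob c y x"
| "first_hit_prob c x (Suc n) y =
     (\<Sum>z | 0 < step_prob c y z \<and> z \<noteq> x. step_prob c y z * first_hit_prob c x n z)"

definition transient :: "('v \<Rightarrow> 'v \<Rightarrow> real) \<Rightarrow> bool" where
  "transient c \<longleftrightarrow> (\<forall>x. (\<Sum>n. first_hit_prob c x n x) < 1)"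


section \<open>Functions modulo constants\<close>

definition differ_by_const :: "('v \<Rightarrow> real) \<Rightarrow> ('v \<Rightarrow> real) \<Rightarrow> bool" where
  "differ_by_const u v \<longleftrightarrow> (\<exists>k. \<forall>x. u x = v x + k)"

lemma equivp_differ_by_const: "equivp (differ_by_const :: ('v \<Rightarrow> real) \<Rightarrow> _)"
proof (rule equivpI)
  show "reflp (differ_by_const :: ('v \<Rightarrow> real) \<Rightarrow> _)"
    unfolding reflp_def differ_by_const_def by (metis add.right_neutral)
  show "symp (differ_by_const :: ('v \<Rightarrow> real) \<Rightarrow> _)"
    unfolding symp_def differ_by_const_def by (metis add_diff_cancel_right' diff_conv_add_uminus)
  show "transp (differ_by_const :: ('v \<Rightarrow> real) \<Rightarrow> _)"
    unfolding transp_def differ_by_const_def by (metis add.assoc)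
qed

quotient_type 'v mod_const = "'v \<Rightarrow> real" / differ_by_const
  morphisms rep_mod_const mod_const
  by (rule equivp_differ_by_const)

lemma differ_by_const_diff:
  "differ_by_const u v \<Longrightarrow> u x - u y = v x - v y"
  unfolding differ_by_const_def by (metis add_diff_cancel_right)

instantiation mod_const :: (type) real_vector
begin

lift_definition zero_mod_const :: "'a mod_const" is "\<lambda>_. 0" .

lift_definition plus_mod_const :: "'a mod_const \<Rightarrow> 'a mod_const \<Rightarrow> 'a mod_const"
  is "\<lambda>u v x. u x + v x"
proof -
  fix u u' v v' :: "'a \<Rightarrow> real"
  assume "differ_by_const u u'" "differ_by_const v v'"
  then obtain k l where "\<forall>x. u x = u' x + k" "\<forall>x. v x = v' x + l"
    by (auto simp: differ_by_const_def)
  then show "differ_by_const (\<lambda>x. u x + v x) (\<lambda>x. u' x + v' x)"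
    unfolding differ_by_const_def by (intro exI[of _ "k + l"]) auto
qed

lift_definition uminus_mod_const :: "'a mod_const \<Rightarrow> 'a mod_const" is "\<lambda>u x. - u x"
  unfolding differ_by_const_def by (metis minus_add_distrib)

lift_definition minus_mod_const :: "'a mod_const \<Rightarrow> 'a mod_const \<Rightarrow> 'a mod_const"
  is "\<lambda>u v x. u x - v x"
proof -
  fix u u' v v' :: "'a \<Rightarrow> real"
  assume "differ_by_const u u'" "differ_by_const v v'"
  then obtain k l where "\<forall>x. u x = u' x + k" "\<forall>x. v x = v' x + l"
    by (auto simp: differ_by_const_def)
  then show "differ_by_const (\<lambda>x. u x - v x) (\<lambda>x. u' x - v' x)"
    unfolding differ_by_const_def by (intro exI[of _ "k - l"]) auto
qed

lift_definition scaleR_mod_const :: "real \<Rightarrow> 'a mod_const \<Rightarrow> 'a mod_const"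
  is "\<lambda>a u x. a * u x"
  unfolding differ_by_const_def by (metis distrib_left)

instance
  by standard (transfer; simp add: differ_by_const_def algebra_simps)+

end

lift_definition increment :: "'v mod_const \<Rightarrow> 'v \<Rightarrow> 'v \<Rightarrow> real" is "\<lambda>u x y. u x - u y"
  by (intro ext differ_by_const_diff)

lift_definition laplacian_mod :: "('v \<Rightarrow> 'v \<Rightarrow> real) \<Rightarrow> 'v mod_const \<Rightarrow> 'v \<Rightarrow> real" is laplacian
  by (auto simp: laplacian_def fun_eq_iff differ_by_const_diff intro!: sum.cong)

lift_definition finite_energy_mod :: "('v \<Rightarrow> 'v \<Rightarrow> real) \<Rightarrow> 'v mod_const \<Rightarrow> bool" is finite_energy
  by (simp add: finite_energy_def differ_by_const_diff)

lift_definition energy_inner ::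
  "('v \<Rightarrow> 'v \<Rightarrow> real) \<Rightarrow> 'v mod_const \<Rightarrow> 'v mod_const \<Rightarrow> real" is energy
  by (simp add: energy_def differ_by_const_diff)


section \<open>The energy space\<close>

definition energy_space :: "('v \<Rightarrow> 'v \<Rightarrow> real) \<Rightarrow> 'v mod_const set" where
  "energy_space c = {u. finite_energy_mod c u}"

definition energy_norm :: "('v \<Rightarrow> 'v \<Rightarrow> real) \<Rightarrow> 'v mod_const \<Rightarrow> real" where
  "energy_norm c u = sqrt (energy_inner c u u)"

definition energy_topology :: "('v \<Rightarrow> 'v \<Rightarrow> real) \<Rightarrow> 'v mod_const topology" where
  "energy_topology c = Metric_space.mtopology (energy_space c) (\<lambda>u v. energy_norm c (u - v))"

text \<open>The reference vertex is called \<open>r\<close>, since \<open>o\<close> is reserved for function composition.\<close>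

definition energy_kernel :: "('v \<Rightarrow> 'v \<Rightarrow> real) \<Rightarrow> 'v \<Rightarrow> 'v \<Rightarrow> 'v mod_const" where
  "energy_kernel c r x =
     (THE v. v \<in> energy_space c \<and> (\<forall>u\<in>energy_space c. energy_inner c v u = increment u x r))"

definition is_monopole :: "('v \<Rightarrow> 'v \<Rightarrow> real) \<Rightarrow> 'v \<Rightarrow> 'v mod_const \<Rightarrow> bool" where
  "is_monopole c x w \<longleftrightarrow> w \<in> energy_space c \<and> laplacian_mod c w = indicator {x}"

definition minimal_monopole :: "('v \<Rightarrow> 'v \<Rightarrow> real) \<Rightarrow> 'v \<Rightarrow> 'v mod_const" where
  "minimal_monopole c r =
     (THE w. is_monopole c r w \<and>
        (\<forall>w'. is_monopole c r w' \<longrightarrow> energy_inner c w w \<le> energy_inner c w' w'))"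

definition monopole :: "('v \<Rightarrow> 'v \<Rightarrow> real) \<Rightarrow> 'v \<Rightarrow> 'v \<Rightarrow> 'v mod_const" where
  "monopole c r x =
     (if x = r then minimal_monopole c r else minimal_monopole c r + energy_kernel c r x)"


section \<open>Square-summable functions\<close>

typedef 'v ell2 = "{u :: 'v \<Rightarrow> real. (\<lambda>x. (u x)\<^sup>2) summable_on UNIV}"
  morphisms ell2_fun Abs_ell2
  by (rule exI[of _ "\<lambda>_. 0"]) simp

setup_lifting type_definition_ell2

lemma summable_on_mult_ell2:
  fixes u v :: "'v \<Rightarrow> real"
  assumes "(\<lambda>x. (u x)\<^sup>2) summable_on UNIV" "(\<lambda>x. (v x)\<^sup>2) summable_on UNIV"
  shows "(\<lambda>x. u x * v x) summable_on UNIV"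
proof -
  have "(\<lambda>x. (u x)\<^sup>2 + (v x)\<^sup>2) summable_on UNIV"
    using assms by (rule summable_on_add)
  moreover have "norm (u x * v x) \<le> (u x)\<^sup>2 + (v x)\<^sup>2" for x
  proof -
    have "2 * \<bar>u x\<bar> * \<bar>v x\<bar> \<le> (u x)\<^sup>2 + (v x)\<^sup>2"
      using sum_squares_bound[of "\<bar>u x\<bar>" "\<bar>v x\<bar>"] by simp
    moreover have "0 \<le> \<bar>u x\<bar> * \<bar>v x\<bar>" by simp
    ultimately show ?thesis by (simp only: real_norm_def abs_mult)
  qed
  ultimately have "(\<lambda>x. norm (u x * v x)) summable_on UNIV"
    by (rule summable_on_comparison_test) simp_all
  then show ?thesis by (rule abs_summable_summable)
qed

lemma summable_on_add_square_ell2: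
  fixes u v :: "'v \<Rightarrow> real"
  assumes "(\<lambda>x. (u x)\<^sup>2) summable_on UNIV" "(\<lambda>x. (v x)\<^sup>2) summable_on UNIV"
  shows "(\<lambda>x. (u x + v x)\<^sup>2) summable_on UNIV"
proof -
  have "(\<lambda>x. (u x)\<^sup>2 + (v x)\<^sup>2 + 2 * (u x * v x)) summable_on UNIV"
    by (intro summable_on_add summable_on_cmult_right summable_on_mult_ell2 assms)
  then show ?thesis by (simp add: power2_sum mult.assoc)
qed

instantiation ell2 :: (type) real_vector
begin

lift_definition zero_ell2 :: "'a ell2" is "\<lambda>_. 0" by simp

lift_definition plus_ell2 :: "'a ell2 \<Rightarrow> 'a ell2 \<Rightarrow> 'a ell2" is "\<lambda>u v x. u x + v x"
  by (rule summable_on_add_square_ell2)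

lift_definition uminus_ell2 :: "'a ell2 \<Rightarrow> 'a ell2" is "\<lambda>u x. - u x" by simp

lift_definition minus_ell2 :: "'a ell2 \<Rightarrow> 'a ell2 \<Rightarrow> 'a ell2" is "\<lambda>u v x. u x - v x"
  subgoal for u v using summable_on_add_square_ell2[of u "\<lambda>x. - v x"] by simp
  done

lift_definition scaleR_ell2 :: "real \<Rightarrow> 'a ell2 \<Rightarrow> 'a ell2" is "\<lambda>a u x. a * u x"
  by (simp add: power_mult_distrib summable_on_cmult_right)

instance
  by standard (transfer; simp add: algebra_simps fun_eq_iff)+

end

instantiation ell2 :: (type) real_inner
begin

lift_definition inner_ell2 :: "'a ell2 \<Rightarrow> 'a ell2 \<Rightarrow> real" is "\<lambda>u v. \<Sum>\<^sub>\<infinity>x. u x * v x" .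

definition norm_ell2 :: "'a ell2 \<Rightarrow> real" where "norm_ell2 u = sqrt (inner u u)"
definition dist_ell2 :: "'a ell2 \<Rightarrow> 'a ell2 \<Rightarrow> real" where "dist_ell2 u v = norm (u - v)"
definition sgn_ell2 :: "'a ell2 \<Rightarrow> 'a ell2" where "sgn_ell2 u = u /\<^sub>R norm u"
definition uniformity_ell2 :: "('a ell2 \<times> 'a ell2) filter" where
  "uniformity_ell2 = (INF e\<in>{0 <..}. principal {(u, v). dist u v < e})"
definition open_ell2 :: "'a ell2 set \<Rightarrow> bool" where
  "open_ell2 U \<longleftrightarrow> (\<forall>u\<in>U. eventually (\<lambda>(u', v). u' = u \<longrightarrow> v \<in> U) uniformity)"

instance
proof
  fix u v w :: "'a ell2" and a :: real
  show "inner u v = inner v u" by transfer (simp add: mult.commute)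
  show "inner (u + v) w = inner u w + inner v w"
    by transfer (simp add: distrib_right infsum_add summable_on_mult_ell2)
  show "inner (a *\<^sub>R u) v = a * inner u v"
    by transfer (simp add: mult.assoc infsum_cmult_right')
  show "0 \<le> inner u u" by transfer (simp add: infsum_nonneg)
  show "inner u u = 0 \<longleftrightarrow> u = 0"
  proof transfer
    fix u :: "'a \<Rightarrow> real"
    assume "(\<lambda>x. (u x)\<^sup>2) summable_on UNIV"
    then have s: "(\<lambda>x. u x * u x) summable_on UNIV" by (simp add: power2_eq_square)
    show "(\<Sum>\<^sub>\<infinity>x. u x * u x) = 0 \<longleftrightarrow> u = (\<lambda>_. 0)"
    proof
      assume z: "(\<Sum>\<^sub>\<infinity>x. u x * u x) = 0"
      have "u x * u x = 0" for x
        using nonneg_infsum_le_0D[of "\<lambda>x. u x * u x" UNIV x] s z by simp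
      then show "u = (\<lambda>_. 0)" by auto
    qed simp
  qed
  show "norm u = sqrt (inner u u)" by (rule norm_ell2_def)
  show "dist u v = norm (u - v)" by (rule dist_ell2_def)
  show "sgn u = u /\<^sub>R norm u" by (rule sgn_ell2_def)
  show "uniformity = (INF e\<in>{0 <..}. principal {(u :: 'a ell2, v). dist u v < e})"
    by (rule uniformity_ell2_def)
  show "open U \<longleftrightarrow> (\<forall>u\<in>U. eventually (\<lambda>(u', v). u' = u \<longrightarrow> v \<in> U) uniformity)"
    for U :: "'a ell2 set"
    by (rule open_ell2_def)
qed

end

lift_definition ell2_delta :: "'v \<Rightarrow> 'v ell2" is "\<lambda>x. indicator {x}"
proof -
  fix x :: 'v
  show "(\<lambda>y. (indicator {x} y :: real)\<^sup>2) summable_on UNIV"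
    by (rule finite_nonzero_values_imp_summable_on)
      (rule finite_subset[of _ "{x}"], auto simp: indicator_def split: if_splits)
qed


section \<open>The operators\<close>

text \<open>Operators that need not be everywhere defined are represented by their graphs.
  Such an operator is bounded if it is bounded on its domain, and its norm is the
  supremum of \<open>\<parallel>T u\<parallel> / \<parallel>u\<parallel>\<close> over its domain. The operators below are closed and densely
  defined, so boundedness forces the domain to be the whole space.\<close>

definition bounded_operator :: "('a \<Rightarrow> real) \<Rightarrow> ('b \<Rightarrow> real) \<Rightarrow> ('a \<times> 'b) set \<Rightarrow> bool" where
  "bounded_operator N M T \<longleftrightarrow> (\<exists>K. \<forall>(u, v)\<in>T. M v \<le> K * N u)"

definition operator_norm :: "('a \<Rightarrow> real) \<Rightarrow> ('b \<Rightarrow> real) \<Rightarrow> ('a \<times> 'b) set \<Rightarrow> real" where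
  "operator_norm N M T = (SUP (u, v)\<in>T. M v / N u)"

definition ell2_laplacian :: "('v \<Rightarrow> 'v \<Rightarrow> real) \<Rightarrow> ('v ell2 \<times> 'v ell2) set" where
  "ell2_laplacian c =
     closure {(u, v). u \<in> span (range ell2_delta) \<and> ell2_fun v = laplacian c (ell2_fun u)}"

definition energy_laplacian ::
  "('v \<Rightarrow> 'v \<Rightarrow> real) \<Rightarrow> 'v \<Rightarrow> ('v mod_const \<times> 'v mod_const) set" where
  "energy_laplacian c r =
     prod_topology (energy_topology c) (energy_topology c) closure_of
       {(u, v). u \<in> span (range (monopole c r)) \<and> v = mod_const (laplacian_mod c u)}"

definition inclusion_operator :: "('v \<Rightarrow> 'v \<Rightarrow> real) \<Rightarrow> ('v ell2 \<times> 'v mod_const) set" where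
  "inclusion_operator c =
     prod_topology euclidean (energy_topology c) closure_of
       {(u, v). u \<in> span (range ell2_delta) \<and> v = mod_const (ell2_fun u)}"

end

theory Submission
  imports Defs
begin

text \<open>
  Write \<open>D\<close> for the finitely supported functions and \<open>M\<close> for the span of the monopoles
  \<open>w\<^sub>x\<close>. Everything follows from summation by parts,
  \<open>\<langle>a, u\<rangle>\<^sub>E = \<langle>a, \<Delta>u\<rangle>\<close> for \<open>a \<in> D\<close> and \<open>u\<close> of finite energy with \<open>\<Delta>u\<close> in \<open>\<ell>\<^sup>2\<close>,
  and the Cauchy-Schwarz inequalities in the two spaces. They show, for each \<open>K \<ge> 0\<close>, that \<open>K\<close>
  is a bound of \<open>\<Delta>\<close> on \<open>\<ell>\<^sup>2\<close> iff \<open>\<surd>K\<close> is a bound of \<open>J\<close> iff \<open>K\<close> is a bound of \<open>\<Delta>\<close> on the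
  energy space. As an operator norm is the least nonnegative bound, this gives the equivalences
  and the norm identities together. A closed operator has the same bounds as the operator that
  it is the closure of, so only \<open>D\<close> and \<open>M\<close> have to be considered:

  \<^item> If \<open>K\<close> bounds \<open>\<Delta>\<close> on \<open>\<ell>\<^sup>2\<close>, then \<open>\<parallel>a\<parallel>\<^sub>E\<^sup>2 = \<langle>a, \<Delta>a\<rangle> \<le> K \<parallel>a\<parallel>\<^sup>2\<close> for \<open>a \<in> D\<close>.
  \<^item> If \<open>\<surd>K\<close> bounds \<open>J\<close>, then for \<open>a \<in> D\<close> and \<open>b = \<Delta>a\<close> it follows that
    \<open>\<parallel>b\<parallel>\<^sup>2 = \<langle>b, a\<rangle>\<^sub>E \<le> \<parallel>b\<parallel>\<^sub>E \<parallel>a\<parallel>\<^sub>E \<le> K \<parallel>b\<parallel> \<parallel>a\<parallel>\<close>. For \<open>w \<in> M\<close> the function \<open>a = \<Delta>w\<close> lies in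
    \<open>D\<close>, and \<open>\<parallel>a\<parallel>\<^sub>E\<^sup>2 \<le> K \<parallel>a\<parallel>\<^sup>2 = K \<langle>a, w\<rangle>\<^sub>E \<le> K \<parallel>a\<parallel>\<^sub>E \<parallel>w\<parallel>\<^sub>E\<close>.
  \<^item> If \<open>K\<close> bounds \<open>\<Delta>\<close> on the energy space, then for \<open>v \<in> M\<close> and \<open>b = \<Delta>v\<close> it follows that
    \<open>\<parallel>b\<parallel>\<^sup>2 = \<langle>b, v\<rangle>\<^sub>E \<le> K \<parallel>v\<parallel>\<^sub>E\<^sup>2\<close>, so \<open>\<langle>a, v\<rangle>\<^sub>E = \<langle>a, b\<rangle> \<le> \<surd>K \<parallel>a\<parallel> \<parallel>v\<parallel>\<^sub>E\<close> for \<open>a \<in> D\<close>. As \<open>M\<close> is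
    dense, \<open>v\<close> may be replaced by \<open>a\<close>, which gives \<open>\<parallel>a\<parallel>\<^sub>E \<le> \<surd>K \<parallel>a\<parallel>\<close>.

  The remaining work is to show that the objects involved exist. The gradient embeds the energy
  space isometrically into \<open>\<ell>\<^sup>2(G \<times> G)\<close>. Its range is complete (\<open>complete_gradient\<close>), so
  orthogonal projections exist; they provide the reproducing kernels, the minimal monopole and the
  density of \<open>M\<close>. Transience is used to construct a monopole from the probability of ever visiting
  a vertex (\<open>transient_imp_monopole\<close>).
\<close>

section \<open>Bounds of operators given by their graphs\<close>

lemma bounded_operator_iff_nonneg_bound:
  assumes "\<And>u. 0 \<le> N u"
  shows "bounded_operator N M T \<longleftrightarrow> (\<exists>K\<ge>0. \<forall>(u, v)\<in>T. M v \<le> K * N u)"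
proof
  assume "bounded_operator N M T"
  then obtain K where K: "\<forall>(u, v)\<in>T. M v \<le> K * N u"
    by (auto simp: bounded_operator_def)
  have "K * N u \<le> max K 0 * N u" for u
    by (rule mult_right_mono) (simp_all add: assms)
  then have "\<forall>(u, v)\<in>T. M v \<le> max K 0 * N u"
    using K by (force intro: order_trans)
  then show "\<exists>K\<ge>0. \<forall>(u, v)\<in>T. M v \<le> K * N u"
    by (intro exI[of _ "max K 0"]) simp
qed (auto simp: bounded_operator_def)

lemma operator_norm_le_iff:
  assumes "bounded_operator N M T" "T \<noteq> {}" "\<And>u. 0 \<le> N u" "\<And>v. 0 \<le> M v" "0 \<le> K"
  shows "operator_norm N M T \<le> K \<longleftrightarrow> (\<forall>(u, v)\<in>T. M v \<le> K * N u)"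
proof -
  obtain B where B: "B \<ge> 0" "\<And>u v. (u, v) \<in> T \<Longrightarrow> M v \<le> B * N u"
    using assms(1) bounded_operator_iff_nonneg_bound[of N M T] assms(3) by blast
  have quot: "M v / N u \<le> C \<longleftrightarrow> M v \<le> C * N u" if "(u, v) \<in> T" "0 \<le> C" for u v C
  proof (cases "N u = 0")
    case True
    then show ?thesis using B(2)[OF that(1)] that(2) by simp
  next
    case False
    then have "0 < N u" using assms(3)[of u] by linarith
    then show ?thesis by (simp add: divide_le_eq)
  qed
  have "bdd_above ((\<lambda>(u, v). M v / N u) ` T)"
    using B quot by (intro bdd_aboveI[of _ B]) force
  then have "operator_norm N M T \<le> K \<longleftrightarrow> (\<forall>p\<in>T. (case p of (u, v) \<Rightarrow> M v / N u) \<le> K)"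
    unfolding operator_norm_def by (intro cSUP_le_iff assms(2))
  also have "\<dots> \<longleftrightarrow> (\<forall>(u, v)\<in>T. M v \<le> K * N u)"
    using quot assms(5) by (intro ball_cong) auto
  finally show ?thesis .
qed

lemma operator_norm_nonneg:
  assumes "bounded_operator N M T" "T \<noteq> {}" "\<And>u. 0 \<le> N u" "\<And>v. 0 \<le> M v"
  shows "0 \<le> operator_norm N M T"
proof (rule ccontr)
  assume neg: "\<not> 0 \<le> operator_norm N M T"
  have zero: "\<forall>(u, v)\<in>T. M v \<le> 0 * N u"
    using operator_norm_le_iff[OF assms order_refl] neg by linarith
  have "M v / N u = 0" if "(u, v) \<in> T" for u v
    using zero that assms(4)[of v] by fastforce
  then have "(\<lambda>(u, v). M v / N u) ` T = (\<lambda>_. 0) ` T"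
    by (intro image_cong) auto
  then have "operator_norm N M T = 0"
    unfolding operator_norm_def using assms(2) by simp
  then show False using neg by simp
qed

text \<open>A graph and a subset approximating it in norm have the same bounds. No linearity is needed.\<close>

lemma graph_bound_approx:
  assumes "0 \<le> K" "T0 \<subseteq> T"
    and approx: "\<And>u v e. (u, v) \<in> T \<Longrightarrow> 0 < e \<Longrightarrow>
      \<exists>(u', v')\<in>T0. \<bar>N u - N u'\<bar> < e \<and> \<bar>M v - M v'\<bar> < e"
  shows "(\<forall>(u, v)\<in>T. M v \<le> (K::real) * N u) \<longleftrightarrow> (\<forall>(u, v)\<in>T0. M v \<le> K * N u)"
proof
  assume core: "\<forall>(u, v)\<in>T0. M v \<le> K * N u"
  show "\<forall>(u, v)\<in>T. M v \<le> K * N u"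
  proof clarify
    fix u v assume uv: "(u, v) \<in> T"
    show "M v \<le> K * N u"
    proof (rule field_le_epsilon)
      fix e :: real assume "0 < e"
      define d where "d = e / (K + 1)"
      have "0 < d" using \<open>0 < e\<close> \<open>0 \<le> K\<close> by (simp add: d_def)
      then obtain u' v' where a: "(u', v') \<in> T0" "\<bar>N u - N u'\<bar> < d" "\<bar>M v - M v'\<bar> < d"
        using approx[OF uv] by blast
      have "M v \<le> M v' + d" using a(3) by linarith
      also have "M v' \<le> K * N u'" using core a(1) by blast
      also have "K * N u' \<le> K * (N u + d)"
        using a(2) \<open>0 \<le> K\<close> by (intro mult_left_mono) linarith+
      also have "K * (N u + d) + d = K * N u + (K + 1) * d"
        by (simp add: algebra_simps)
      also have "(K + 1) * d = e"
        using \<open>0 \<le> K\<close> by (simp add: d_def)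
      finally show "M v \<le> K * N u + e" by simp
    qed
  qed
qed (use assms(2) in blast)

lemma closure_of_prod_topologyD:
  assumes "(u, v) \<in> prod_topology X Y closure_of S"
    and "openin X U" "u \<in> U" "openin Y V" "v \<in> V"
  shows "\<exists>(u', v')\<in>S. u' \<in> U \<and> v' \<in> V"
proof -
  have "openin (prod_topology X Y) (U \<times> V)"
    using assms by (simp add: openin_prod_Times_iff)
  moreover have "(u, v) \<in> U \<times> V" using assms by simp
  moreover have "\<And>T. (u, v) \<in> T \<and> openin (prod_topology X Y) T \<Longrightarrow> \<exists>p\<in>S. p \<in> T"
    using assms(1) by (auto simp: in_closure_of)
  ultimately have "\<exists>p\<in>S. p \<in> U \<times> V" by metis
  then show ?thesis by auto
qed


section \<open>Orthogonal projection onto a complete subspace\<close>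

theorem orthogonal_projection_exists:
  fixes S :: "'a::real_inner set"
  assumes "subspace S" "complete S"
  obtains s where "s \<in> S" "\<And>z. z \<in> S \<Longrightarrow> inner (x - s) z = 0"
proof -
  define q where "q s = (norm (x - s))\<^sup>2" for s
  define D where "D = Inf (q ` S)"
  have ne: "q ` S \<noteq> {}" using subspace_0[OF assms(1)] by blast
  have bdd: "bdd_below (q ` S)" by (rule bdd_belowI[of _ 0]) (auto simp: q_def)
  have D_le: "D \<le> q s" if "s \<in> S" for s
    unfolding D_def using bdd that by (intro cInf_lower) auto
  have "\<exists>s\<in>S. q s < D + 1 / (real n + 1)" for n
  proof -
    have "D < D + 1 / (real n + 1)" by simp
    then show ?thesis
      unfolding D_def using cInf_less_iff[OF ne bdd] by (metis (no_types, lifting) imageE)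
  qed
  then obtain \<sigma> where \<sigma>: "\<And>n. \<sigma> n \<in> S" "\<And>n. q (\<sigma> n) < D + 1 / (real n + 1)"
    by metis
  have parallelogram: "(norm (s - t))\<^sup>2 \<le> 2 * (q s - D) + 2 * (q t - D)"
    if "s \<in> S" "t \<in> S" for s t
  proof -
    define m where "m = (1/2) *\<^sub>R (s + t)"
    have "m \<in> S"
      unfolding m_def using that assms(1) by (intro subspace_scale subspace_add)
    then have "D \<le> q m" by (rule D_le)
    moreover have "(norm (s - t))\<^sup>2 = 2 * q s + 2 * q t - 4 * q m"
      by (simp add: m_def q_def power2_norm_eq_inner inner_diff_left inner_diff_right
          inner_add_left inner_add_right inner_commute algebra_simps)
    ultimately show ?thesis by argo
  qed
  have "Cauchy \<sigma>"
  proof (rule metric_CauchyI)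
    fix e :: real assume "0 < e"
    obtain k where k: "1 / (real k + 1) < e\<^sup>2 / 4"
      using reals_Archimedean[of "e\<^sup>2 / 4"] \<open>0 < e\<close> by (auto simp: inverse_eq_divide add.commute)
    have small: "q (\<sigma> n) - D < e\<^sup>2 / 4" if "n \<ge> k" for n
    proof -
      have "1 / (real n + 1) \<le> 1 / (real k + 1)"
        using that by (intro divide_left_mono) auto
      then show ?thesis using \<sigma>(2)[of n] k by linarith
    qed
    show "\<exists>k. \<forall>m\<ge>k. \<forall>n\<ge>k. dist (\<sigma> m) (\<sigma> n) < e"
    proof (intro exI allI impI)
      fix m n assume mn: "k \<le> m" "k \<le> n"
      have "(norm (\<sigma> m - \<sigma> n))\<^sup>2 < e\<^sup>2"
        using parallelogram[OF \<sigma>(1) \<sigma>(1), of m n] small[OF mn(1)] small[OF mn(2)] by argo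
      then show "dist (\<sigma> m) (\<sigma> n) < e"
        using \<open>0 < e\<close> by (simp add: dist_norm power_less_imp_less_base)
    qed
  qed
  then obtain s where s: "s \<in> S" "\<sigma> \<longlonglongrightarrow> s"
    using assms(2) \<sigma>(1) unfolding complete_def by blast
  have "q s \<le> D"
  proof (rule LIMSEQ_le)
    show "(\<lambda>n. q (\<sigma> n)) \<longlonglongrightarrow> q s"
      unfolding q_def by (intro tendsto_intros s)
    have "(\<lambda>n. D + 1 / (real n + 1)) \<longlonglongrightarrow> D + 0"
      using LIMSEQ_inverse_real_of_nat
      by (intro tendsto_add tendsto_const) (simp add: inverse_eq_divide add.commute)
    then show "(\<lambda>n. D + 1 / (real n + 1)) \<longlonglongrightarrow> D" by simp
    show "\<exists>N. \<forall>n\<ge>N. q (\<sigma> n) \<le> D + 1 / (real n + 1)"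
      using \<sigma>(2) less_imp_le by blast
  qed
  have "inner (x - s) z = 0" if "z \<in> S" for z
  proof (cases "z = 0")
    case False
    \<comment> \<open>This \<open>t\<close> minimises the distance from \<open>x\<close> to \<open>s + t z\<close>.\<close>
    define t where "t = inner (x - s) z / inner z z"
    have "s + t *\<^sub>R z \<in> S"
      using s(1) that assms(1) by (intro subspace_add subspace_scale)
    then have "q s \<le> q (s + t *\<^sub>R z)"
      using D_le \<open>q s \<le> D\<close> by force
    moreover have "q (s + t *\<^sub>R z) = q s - (inner (x - s) z)\<^sup>2 / inner z z"
    proof -
      have "q (s + t *\<^sub>R z) = q s - 2 * t * inner (x - s) z + t * (t * inner z z)"
        by (simp add: q_def power2_norm_eq_inner inner_diff_left inner_diff_right
            inner_add_left inner_add_right inner_commute algebra_simps)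
      also have "t * inner z z = inner (x - s) z" using False by (simp add: t_def)
      finally show ?thesis by (simp add: t_def power2_eq_square)
    qed
    ultimately have "(inner (x - s) z)\<^sup>2 / inner z z \<le> 0" by linarith
    moreover have "0 < inner z z" using False by simp
    ultimately have "(inner (x - s) z)\<^sup>2 \<le> 0" by (simp add: divide_le_0_iff)
    then show ?thesis by simp
  qed simp
  with s(1) show thesis by (rule that)
qed

lemma subspace_closure:
  fixes S :: "'a::real_normed_vector set"
  assumes "subspace S"
  shows "subspace (closure S)"
proof (rule subspaceI)
  show "0 \<in> closure S" using subspace_0[OF assms] closure_subset by blast
next
  fix x y assume "x \<in> closure S" "y \<in> closure S"
  then obtain f g where fg: "\<And>n. f n \<in> S" "f \<longlonglongrightarrow> x" "\<And>n. g n \<in> S" "g \<longlonglongrightarrow> y"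
    unfolding closure_sequential by blast
  then have "(\<lambda>n. f n + g n) \<longlonglongrightarrow> x + y" by (intro tendsto_add)
  moreover have "f n + g n \<in> S" for n by (intro subspace_add assms fg)
  ultimately show "x + y \<in> closure S"
    unfolding closure_sequential by (intro exI[of _ "\<lambda>n. f n + g n"]) simp
next
  fix a x assume "x \<in> closure S"
  then obtain f where f: "\<And>n. f n \<in> S" "f \<longlonglongrightarrow> x"
    unfolding closure_sequential by blast
  then have "(\<lambda>n. a *\<^sub>R f n) \<longlonglongrightarrow> a *\<^sub>R x" by (intro tendsto_scaleR tendsto_const)
  moreover have "a *\<^sub>R f n \<in> S" for n by (intro subspace_scale assms f)
  ultimately show "a *\<^sub>R x \<in> closure S"
    unfolding closure_sequential by (intro exI[of _ "\<lambda>n. a *\<^sub>R f n"]) simp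
qed


section \<open>Square-summable functions\<close>

lemma inner_ell2_delta_left: "inner (ell2_delta x) u = ell2_fun u x"
proof transfer
  fix x :: 'a and u :: "'a \<Rightarrow> real"
  have "(\<Sum>\<^sub>\<infinity>y. indicator {x} y * u y) = (\<Sum>\<^sub>\<infinity>y\<in>{x}. u y)"
    by (rule infsum_cong_neutral) auto
  then show "(\<Sum>\<^sub>\<infinity>y. indicator {x} y * u y) = u x" by simp
qed

lemma ell2_fun_eqI: "(\<And>x. ell2_fun u x = ell2_fun v x) \<Longrightarrow> u = v"
  by (metis ell2_fun_inject ext)

lemma sum_squares_le_norm_ell2:
  assumes "finite F"
  shows "(\<Sum>x\<in>F. (ell2_fun u x)\<^sup>2) \<le> (norm u)\<^sup>2"
proof -
  have "(\<lambda>x. (ell2_fun u x)\<^sup>2) summable_on UNIV" using ell2_fun[of u] by simp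
  then have "(\<Sum>x\<in>F. (ell2_fun u x)\<^sup>2) \<le> (\<Sum>\<^sub>\<infinity>x. (ell2_fun u x)\<^sup>2)"
    by (rule finite_sum_le_infsum) (use assms in auto)
  also have "\<dots> = (norm u)\<^sup>2"
    unfolding power2_norm_eq_inner by transfer (simp add: power2_eq_square)
  finally show ?thesis .
qed

lemma square_summable_normI:
  assumes "\<And>F. finite F \<Longrightarrow> (\<Sum>x\<in>F. (f x)\<^sup>2) \<le> (C::real)"
  shows "(\<lambda>x. (f x)\<^sup>2) summable_on UNIV" "(norm (Abs_ell2 f))\<^sup>2 \<le> C"
proof -
  show s: "(\<lambda>x. (f x)\<^sup>2) summable_on UNIV"
    by (rule nonneg_bdd_above_summable_on) (use assms in \<open>auto intro!: bdd_aboveI[of _ C]\<close>)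
  have "(norm (Abs_ell2 f))\<^sup>2 = (\<Sum>\<^sub>\<infinity>x. (f x)\<^sup>2)"
    unfolding power2_norm_eq_inner inner_ell2.rep_eq
    using s by (simp add: Abs_ell2_inverse power2_eq_square)
  also have "\<dots> \<le> C" by (rule infsum_le_finite_sums) (use s assms in auto)
  finally show "(norm (Abs_ell2 f))\<^sup>2 \<le> C" .
qed

lemma ell2_fun_sum: "ell2_fun (sum g F) y = (\<Sum>x\<in>F. ell2_fun (g x) y)"
  by (induction F rule: infinite_finite_induct) (simp_all add: zero_ell2.rep_eq plus_ell2.rep_eq)

lemma finite_support_in_span_delta:
  assumes "finite {x. f x \<noteq> (0::real)}"
  shows "\<exists>a\<in>span (range ell2_delta). ell2_fun a = f"
proof -
  let ?A = "{x. f x \<noteq> 0}"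
  have "ell2_fun (\<Sum>x\<in>?A. f x *\<^sub>R ell2_delta x) y = f y" for y
    by (cases "f y = 0")
      (simp_all add: assms ell2_fun_sum scaleR_ell2.rep_eq ell2_delta.rep_eq indicator_def
        Int_insert_right)
  moreover have "(\<Sum>x\<in>?A. f x *\<^sub>R ell2_delta x) \<in> span (range ell2_delta)"
    by (intro span_sum span_scale span_base rangeI)
  ultimately show ?thesis by blast
qed


section \<open>The energy space as a Hilbert space\<close>

lemma increment_mod_const [simp]: "increment (mod_const f) x y = f x - f y"
  by (simp add: increment.abs_eq)

lemma increment_add [simp]: "increment (u + v) x y = increment u x y + increment v x y"
  by transfer simp

lemma increment_diff [simp]: "increment (u - v) x y = increment u x y - increment v x y"
  by transfer simp

lemma increment_scaleR [simp]: "increment (a *\<^sub>R u) x y = a * increment u x y"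
  by transfer (simp add: algebra_simps)

lemma increment_zero [simp]: "increment 0 x y = 0"
  by transfer simp

lemma increment_split: "increment u x y = increment u x z - increment u y z"
  by transfer simp

lemma mod_const_eqI:
  assumes "\<And>x. increment u x y = increment v x y"
  shows "u = v"
  using assms
proof transfer
  fix u v :: "'a \<Rightarrow> real" and y
  assume "\<And>x. u x - u y = v x - v y"
  then have "\<forall>x. u x = v x + (u y - v y)" by (simp add: algebra_simps)
  then show "differ_by_const u v" unfolding differ_by_const_def by blast
qed

lemma laplacian_mod_increment:
  "laplacian_mod c u x = (\<Sum>y | 0 < c x y. c x y * increment u x y)"
  by transfer (simp add: laplacian_def)

lemma laplacian_mod_add:
  "laplacian_mod c (u + v) x = laplacian_mod c u x + laplacian_mod c v x"
  by (simp add: laplacian_mod_increment distrib_left sum.distrib)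

lemma laplacian_mod_diff:
  "laplacian_mod c (u - v) x = laplacian_mod c u x - laplacian_mod c v x"
  by (simp add: laplacian_mod_increment right_diff_distrib sum_subtractf)

lemma laplacian_mod_scaleR: "laplacian_mod c (a *\<^sub>R u) x = a * laplacian_mod c u x"
  by (simp add: laplacian_mod_increment sum_distrib_left mult.left_commute)

lemma laplacian_mod_zero: "laplacian_mod c 0 x = 0"
  by (simp add: laplacian_mod_increment)

lemma finite_energy_mod_increment:
  "finite_energy_mod c u \<longleftrightarrow> (\<lambda>(x, y). c x y * (increment u x y)\<^sup>2) summable_on UNIV"
  by transfer (simp add: finite_energy_def)

lemma energy_inner_increment:
  "energy_inner c u v =
     1/2 * (\<Sum>\<^sub>\<infinity>(x, y)\<in>UNIV. c x y * increment u x y * increment v x y)"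
  by transfer (simp add: energy_def)

text \<open>The square of the gradient at an edge \<open>(x, y)\<close> is the contribution of that ordered pair
  to the energy, so that the energy form becomes the inner product of \<open>\<ell>\<^sup>2(G \<times> G)\<close>.
  Outside the energy space the value is meaningless.\<close>

definition gradient :: "('v \<Rightarrow> 'v \<Rightarrow> real) \<Rightarrow> 'v mod_const \<Rightarrow> ('v \<times> 'v) ell2" where
  "gradient c u = Abs_ell2 (\<lambda>(x, y). sqrt (c x y / 2) * increment u x y)"

context network
begin

abbreviation "H \<equiv> energy_space c"

lemma gradient_square:
  "(sqrt (c x y / 2) * increment u x y)\<^sup>2 = 1/2 * (c x y * (increment u x y)\<^sup>2)"
  using conductance_nonneg[of x y] by (simp add: power_mult_distrib)

lemma energy_space_iff:
  "u \<in> H \<longleftrightarrow>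
     (\<lambda>p. ((\<lambda>(x, y). sqrt (c x y / 2) * increment u x y) p)\<^sup>2) summable_on UNIV"
proof -
  have "(\<lambda>p. ((\<lambda>(x, y). sqrt (c x y / 2) * increment u x y) p)\<^sup>2) =
      (\<lambda>p. 1/2 * (\<lambda>(x, y). c x y * (increment u x y)\<^sup>2) p)"
    using gradient_square by (simp add: fun_eq_iff split_beta)
  then show ?thesis
    unfolding energy_space_def finite_energy_mod_increment mem_Collect_eq
    using summable_on_cmult_right'[of "1/2::real" "\<lambda>(x, y). c x y * (increment u x y)\<^sup>2" UNIV]
    by (simp only:)
qed

lemma gradient_apply:
  assumes "u \<in> H"
  shows "ell2_fun (gradient c u) (x, y) = sqrt (c x y / 2) * increment u x y"
  using assms unfolding energy_space_iff gradient_def by (subst Abs_ell2_inverse) auto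

lemma subspace_energy_space: "subspace H"
proof (rule subspaceI)
  show "0 \<in> H" by (simp add: energy_space_iff split_beta)
next
  fix u v assume "u \<in> H" "v \<in> H"
  then show "u + v \<in> H"
    unfolding energy_space_iff
    by (auto simp: split_beta distrib_left dest: summable_on_add_square_ell2)
next
  fix a u assume "u \<in> H"
  then show "a *\<^sub>R u \<in> H"
    unfolding energy_space_iff
    by (auto simp: split_beta power_mult_distrib mult.left_commute[of _ a]
        intro: summable_on_cmult_right)
qed

lemmas energy_space_add = subspace_add[OF subspace_energy_space]
  and energy_space_diff = subspace_diff[OF subspace_energy_space]
  and energy_space_scaleR = subspace_scale[OF subspace_energy_space]
  and energy_space_zero = subspace_0[OF subspace_energy_space]

lemma gradient_add:
  "u \<in> H \<Longrightarrow> v \<in> H \<Longrightarrow> gradient c (u + v) = gradient c u + gradient c v"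
  by (rule ell2_fun_eqI)
    (auto simp: gradient_apply energy_space_add plus_ell2.rep_eq distrib_left)

lemma gradient_diff:
  "u \<in> H \<Longrightarrow> v \<in> H \<Longrightarrow> gradient c (u - v) = gradient c u - gradient c v"
  by (rule ell2_fun_eqI)
    (auto simp: gradient_apply energy_space_diff minus_ell2.rep_eq right_diff_distrib)

lemma gradient_scaleR: "u \<in> H \<Longrightarrow> gradient c (a *\<^sub>R u) = a *\<^sub>R gradient c u"
  by (rule ell2_fun_eqI)
    (auto simp: gradient_apply energy_space_scaleR scaleR_ell2.rep_eq)

lemma gradient_zero: "gradient c 0 = 0"
  by (rule ell2_fun_eqI) (auto simp: gradient_apply energy_space_zero zero_ell2.rep_eq)

lemma subspace_gradient:
  assumes "subspace S" "S \<subseteq> H"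
  shows "subspace (gradient c ` S)"
proof (rule subspaceI)
  show "0 \<in> gradient c ` S"
    using subspace_0[OF assms(1)] gradient_zero by (metis imageI)
next
  fix f g assume "f \<in> gradient c ` S" "g \<in> gradient c ` S"
  then obtain u v where uv: "f = gradient c u" "g = gradient c v" "u \<in> S" "v \<in> S" by blast
  then have "f + g = gradient c (u + v)"
    using assms(2) by (simp add: gradient_add subset_iff)
  moreover have "u + v \<in> S" using uv by (intro subspace_add[OF assms(1)])
  ultimately show "f + g \<in> gradient c ` S" by simp
next
  fix a f assume "f \<in> gradient c ` S"
  then obtain u where u: "f = gradient c u" "u \<in> S" by blast
  then have "a *\<^sub>R f = gradient c (a *\<^sub>R u)"
    using assms(2) by (simp add: gradient_scaleR subset_iff)
  moreover have "a *\<^sub>R u \<in> S" using u by (intro subspace_scale[OF assms(1)])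
  ultimately show "a *\<^sub>R f \<in> gradient c ` S" by simp
qed

lemma energy_inner_eq_inner:
  assumes "u \<in> H" "v \<in> H"
  shows "energy_inner c u v = inner (gradient c u) (gradient c v)"
proof -
  have "sqrt (c x y / 2) * increment u x y * (sqrt (c x y / 2) * increment v x y) =
      1/2 * (c x y * increment u x y * increment v x y)" for x y
  proof -
    have "sqrt (c x y / 2) * sqrt (c x y / 2) = c x y / 2"
      using conductance_nonneg[of x y] by simp
    then show ?thesis by (simp add: algebra_simps)
  qed
  then have "(\<lambda>p. ell2_fun (gradient c u) p * ell2_fun (gradient c v) p) =
      (\<lambda>p. 1/2 * (\<lambda>(x, y). c x y * increment u x y * increment v x y) p)"
    using assms by (auto simp: fun_eq_iff gradient_apply)
  then show ?thesis
    unfolding energy_inner_increment inner_ell2.rep_eq by (simp only: infsum_cmult_right')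
qed

lemma energy_norm_eq_norm: "u \<in> H \<Longrightarrow> energy_norm c u = norm (gradient c u)"
  by (simp add: energy_norm_def energy_inner_eq_inner norm_eq_sqrt_inner)

text \<open>Point differences are bounded functionals: a difference across an edge is a rescaled
  coordinate of the gradient, and connectedness joins any two vertices by a path.\<close>

lemma increment_bounded_functional:
  "\<exists>p. \<forall>u\<in>H. inner p (gradient c u) = increment u x y"
proof -
  have "(\<lambda>x y. 0 < c x y)\<^sup>*\<^sup>* y x" by (rule network_connected)
  then show ?thesis
  proof (induction rule: rtranclp_induct)
    case base
    have "increment u y y = 0" for u using increment_split[of u y y y] by simp
    then show ?case by (intro exI[of _ 0]) simp
  next
    case (step x z)
    then obtain p where p: "\<forall>u\<in>H. inner p (gradient c u) = increment u x y" by blast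
    let ?s = "sqrt (c x z / 2)"
    have "inner (p - (1 / ?s) *\<^sub>R ell2_delta (x, z)) (gradient c u) = increment u z y"
      if "u \<in> H" for u
      using p that step(2) increment_split[of u x z y]
      by (simp add: inner_diff_left inner_ell2_delta_left gradient_apply)
    then show ?case by blast
  qed
qed

lemma gradient_inj:
  assumes "u \<in> H" "v \<in> H" "gradient c u = gradient c v"
  shows "u = v"
proof (rule mod_const_eqI)
  fix x
  obtain p where "\<forall>u\<in>H. inner p (gradient c u) = increment u x undefined"
    using increment_bounded_functional by blast
  then show "increment u x undefined = increment v x undefined" using assms by metis
qed

text \<open>Fatou's lemma for the energy.\<close>

lemma energy_norm_limit_le:
  assumes "\<And>n. u n \<in> H" and "\<forall>\<^sub>F n in sequentially. energy_norm c (u n) \<le> C"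
    and lim: "\<And>x y. (\<lambda>n. increment (u n) x y) \<longlonglongrightarrow> increment w x y"
  shows "w \<in> H" "energy_norm c w \<le> C"
proof -
  let ?g = "\<lambda>(x, y). sqrt (c x y / 2) * increment w x y"
  have "0 \<le> C"
  proof -
    obtain n where "energy_norm c (u n) \<le> C"
      using eventually_happens[OF assms(2)] by auto
    then show ?thesis
      using energy_norm_eq_norm[OF assms(1), of n] norm_ge_zero order_trans by metis
  qed
  have *: "(\<Sum>p\<in>F. (?g p)\<^sup>2) \<le> C\<^sup>2" if "finite F" for F
  proof (rule tendsto_upperbound)
    show "(\<lambda>n. \<Sum>(x, y)\<in>F. (sqrt (c x y / 2) * increment (u n) x y)\<^sup>2)
        \<longlonglongrightarrow> (\<Sum>p\<in>F. (?g p)\<^sup>2)"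
      unfolding split_beta by (intro tendsto_intros lim)
    have bound: "(\<Sum>(x, y)\<in>F. (sqrt (c x y / 2) * increment (u n) x y)\<^sup>2) \<le> C\<^sup>2"
      if "energy_norm c (u n) \<le> C" for n
    proof -
      have "(\<Sum>(x, y)\<in>F. (sqrt (c x y / 2) * increment (u n) x y)\<^sup>2) =
          (\<Sum>p\<in>F. (ell2_fun (gradient c (u n)) p)\<^sup>2)"
        by (rule sum.cong) (auto simp: gradient_apply assms(1))
      also have "\<dots> \<le> (norm (gradient c (u n)))\<^sup>2"
        by (rule sum_squares_le_norm_ell2[OF \<open>finite F\<close>])
      also have "\<dots> \<le> C\<^sup>2"
        using that energy_norm_eq_norm[OF assms(1)] by (simp add: power_mono)
      finally show ?thesis .
    qed
    show "\<forall>\<^sub>F n in sequentially.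
        (\<Sum>(x, y)\<in>F. (sqrt (c x y / 2) * increment (u n) x y)\<^sup>2) \<le> C\<^sup>2"
      using assms(2) by (rule eventually_mono) (rule bound)
  qed simp
  show "w \<in> H" unfolding energy_space_iff by (rule square_summable_normI(1)[OF *])
  then have "(energy_norm c w)\<^sup>2 \<le> C\<^sup>2"
    using square_summable_normI(2)[of ?g, OF *] by (simp add: energy_norm_eq_norm gradient_def)
  then show "energy_norm c w \<le> C" using \<open>0 \<le> C\<close> by (rule power2_le_imp_le)
qed

theorem complete_gradient: "complete (gradient c ` H)"
  unfolding complete_def
proof (intro allI impI, elim conjE)
  fix g assume "\<forall>n. g n \<in> gradient c ` H" and "Cauchy g"
  then have "\<forall>n. \<exists>u. u \<in> H \<and> g n = gradient c u" by blast
  then obtain u where u: "\<And>n. u n \<in> H" "\<And>n. g n = gradient c (u n)" by metis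
  define w where "w = mod_const (\<lambda>x. lim (\<lambda>n. increment (u n) x undefined))"
  have lim0: "(\<lambda>n. increment (u n) x undefined) \<longlonglongrightarrow> increment w x undefined" for x
  proof -
    have conv: "convergent (\<lambda>n. increment (u n) x undefined)" for x
    proof -
      obtain p where "\<forall>u\<in>H. inner p (gradient c u) = increment u x undefined"
        using increment_bounded_functional by blast
      then have "(\<lambda>n. increment (u n) x undefined) = (\<lambda>n. inner p (g n))"
        using u by auto
      then show ?thesis
        using bounded_linear.Cauchy[OF bounded_linear_inner_right \<open>Cauchy g\<close>, of p]
        by (simp add: Cauchy_convergent)
    qed
    have "increment (u n) undefined undefined = 0" for n
      using increment_split[of "u n" undefined undefined undefined] by simp
    then have "lim (\<lambda>n. increment (u n) undefined undefined) = 0" by simp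
    then show ?thesis using conv[of x] by (simp add: w_def convergent_LIMSEQ_iff)
  qed
  have lim: "(\<lambda>n. increment (u n) x y) \<longlonglongrightarrow> increment w x y" for x y
    using tendsto_diff[OF lim0[of x] lim0[of y]] by (simp flip: increment_split)
  have close: "\<exists>N. \<forall>n\<ge>N. u n - w \<in> H \<and> energy_norm c (u n - w) \<le> e" if "0 < e" for e
  proof -
    obtain N where N: "\<And>m n. N \<le> m \<Longrightarrow> N \<le> n \<Longrightarrow> dist (g m) (g n) < e"
      using metric_CauchyD[OF \<open>Cauchy g\<close> \<open>0 < e\<close>] by blast
    have "u n - w \<in> H \<and> energy_norm c (u n - w) \<le> e" if "N \<le> n" for n
    proof -
      have in_H: "u n - u m \<in> H" for m by (intro energy_space_diff u)
      have "energy_norm c (u n - u m) \<le> e" if "N \<le> m" for m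
        using N[OF \<open>N \<le> n\<close> that] u in_H
        by (simp add: energy_norm_eq_norm gradient_diff dist_norm)
      then have ev: "\<forall>\<^sub>F m in sequentially. energy_norm c (u n - u m) \<le> e"
        using eventually_sequentially by blast
      have "(\<lambda>m. increment (u n - u m) x y) \<longlonglongrightarrow> increment (u n - w) x y" for x y
        by (simp, intro tendsto_intros lim)
      then show ?thesis
        using energy_norm_limit_le[of "\<lambda>m. u n - u m", OF in_H ev] by blast
    qed
    then show ?thesis by blast
  qed
  have w: "w \<in> H"
  proof -
    obtain n where "u n - w \<in> H" using close[of 1] by auto
    then have "u n - (u n - w) \<in> H" by (rule energy_space_diff[OF u(1)])
    moreover have "u n - (u n - w) = w" by simp
    ultimately show ?thesis by (rule back_subst)
  qed
  have "g \<longlonglongrightarrow> gradient c w"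
  proof (rule metric_LIMSEQ_I)
    fix e :: real assume "0 < e"
    obtain N where N: "\<forall>n\<ge>N. u n - w \<in> H \<and> energy_norm c (u n - w) \<le> e / 2"
      using close[of "e / 2"] \<open>0 < e\<close> by auto
    have "dist (g n) (gradient c w) < e" if "N \<le> n" for n
    proof -
      have "dist (g n) (gradient c w) = energy_norm c (u n - w)"
        using u w by (simp add: dist_norm energy_norm_eq_norm gradient_diff energy_space_diff)
      also have "\<dots> \<le> e / 2" using N that by blast
      finally show ?thesis using \<open>0 < e\<close> by simp
    qed
    then show "\<exists>N. \<forall>n\<ge>N. dist (g n) (gradient c w) < e" by blast
  qed
  then show "\<exists>l\<in>gradient c ` H. g \<longlonglongrightarrow> l" using w by blast
qed


section \<open>Finitely supported functions in the energy space\<close>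

text \<open>The finitely supported functions.\<close>

abbreviation "D \<equiv> span (range (ell2_delta :: 'v \<Rightarrow> 'v ell2))"

text \<open>On \<open>D\<close> this is the inclusion into the energy space.\<close>

abbreviation energy_class :: "'v ell2 \<Rightarrow> 'v mod_const"
  where "energy_class a \<equiv> mod_const (ell2_fun a)"

lemma finite_support_span_delta:
  assumes "a \<in> D"
  shows "finite {x. ell2_fun a x \<noteq> 0}"
proof -
  have "subspace {a :: 'v ell2. finite {x. ell2_fun a x \<noteq> 0}}"
  proof (rule subspaceI; clarsimp)
    show "finite {x. ell2_fun (0 :: 'v ell2) x \<noteq> 0}" by (simp add: zero_ell2.rep_eq)
  next
    fix a b :: "'v ell2"
    assume "finite {x. ell2_fun a x \<noteq> 0}" "finite {x. ell2_fun b x \<noteq> 0}"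
    then have "finite ({x. ell2_fun a x \<noteq> 0} \<union> {x. ell2_fun b x \<noteq> 0})" by simp
    then show "finite {x. ell2_fun (a + b) x \<noteq> 0}"
      by (rule finite_subset[rotated]) (auto simp: plus_ell2.rep_eq)
  next
    fix k and a :: "'v ell2"
    assume "finite {x. ell2_fun a x \<noteq> 0}"
    then show "finite {x. ell2_fun (k *\<^sub>R a) x \<noteq> 0}"
      by (rule finite_subset[rotated]) (auto simp: scaleR_ell2.rep_eq)
  qed
  then have "D \<subseteq> {a. finite {x. ell2_fun a x \<noteq> 0}}"
    by (intro span_minimal) (auto simp: ell2_delta.rep_eq indicator_def)
  then show ?thesis using assms by blast
qed

lemma finite_support_laplacian:
  assumes "finite {x. f x \<noteq> 0}"
  shows "finite {x. laplacian c f x \<noteq> 0}"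
proof (rule finite_subset)
  show "finite ({x. f x \<noteq> 0} \<union> (\<Union>y\<in>{x. f x \<noteq> 0}. {x. 0 < c y x}))"
    using assms locally_finite by simp
  show "{x. laplacian c f x \<noteq> 0} \<subseteq> {x. f x \<noteq> 0} \<union> (\<Union>y\<in>{x. f x \<noteq> 0}. {x. 0 < c y x})"
  proof
    fix x assume "x \<in> {x. laplacian c f x \<noteq> 0}"
    then have "(\<Sum>y | 0 < c x y. c x y * (f x - f y)) \<noteq> 0"
      by (simp add: laplacian_def)
    then obtain y where "0 < c x y" "f x - f y \<noteq> 0"
      by (rule sum.not_neutral_contains_not_neutral) auto
    then show "x \<in> {x. f x \<noteq> 0} \<union> (\<Union>y\<in>{x. f x \<noteq> 0}. {x. 0 < c y x})"
      using conductance_sym[of x y] by (cases "f x = 0") auto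
  qed
qed

lemma laplacian_span_delta:
  assumes "a \<in> D"
  obtains b where "b \<in> D" "ell2_fun b = laplacian c (ell2_fun a)"
  using that finite_support_in_span_delta
    [OF finite_support_laplacian[OF finite_support_span_delta[OF assms]]]
  by blast

lemma linear_energy_class: "linear energy_class"
  by (rule linearI)
    (simp_all add: plus_ell2.rep_eq scaleR_ell2.rep_eq plus_mod_const.abs_eq
      scaleR_mod_const.abs_eq)

text \<open>Only the edges at \<open>x\<close>, in both orientations, contribute to the energy of \<open>\<delta>\<^sub>x\<close>.\<close>

lemma delta_pairs:
  assumes "c a b * (indicator {x} a - indicator {x} b) \<noteq> (0::real)"
  shows "(a, b) \<in> Pair x ` {y. 0 < c x y} \<union> (\<lambda>y. (y, x)) ` {y. 0 < c x y}"
proof -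
  have "0 < c a b" "0 < c b a"
    using assms conductance_nonneg[of a b] conductance_sym[of a b] by (auto simp: less_le)
  moreover have "a = x \<or> b = x" using assms by (auto simp: indicator_def)
  ultimately show ?thesis by auto
qed

lemma delta_in_energy_space: "mod_const (indicator {x}) \<in> H"
proof -
  let ?P = "Pair x ` {y. 0 < c x y} \<union> (\<lambda>y. (y, x)) ` {y. 0 < c x y}"
  have "{p. (case p of (a, b) \<Rightarrow> c a b * (indicator {x} a - indicator {x} b :: real)\<^sup>2) \<noteq> 0} \<subseteq> ?P"
    using delta_pairs by fastforce
  moreover have "finite ?P" using locally_finite by simp
  ultimately have "finite {p. (case p of (a, b) \<Rightarrow>
      c a b * (indicator {x} a - indicator {x} b :: real)\<^sup>2) \<noteq> 0}"
    by (rule finite_subset)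
  then show ?thesis
    unfolding energy_space_def finite_energy_mod_increment mem_Collect_eq increment_mod_const
    by (intro finite_nonzero_values_imp_summable_on) simp
qed

lemma energy_inner_delta:
  "energy_inner c (mod_const (indicator {x})) u = laplacian_mod c u x"
proof -
  let ?N = "{y. 0 < c x y}" and ?d = "\<lambda>a b. indicator {x} a - indicator {x} b :: real"
  let ?f = "\<lambda>(a, b). c a b * ?d a b * increment u a b"
  let ?A = "Pair x ` ?N" and ?B = "(\<lambda>y. (y, x)) ` ?N"
  have fin: "finite ?N" by (rule locally_finite)
  have "?A \<inter> ?B = {}" using no_loops by auto
  have "infsum ?f UNIV = infsum ?f (?A \<union> ?B)"
  proof (rule infsum_cong_neutral)
    fix p assume p: "p \<in> UNIV - (?A \<union> ?B)"
    obtain a b where ab: "p = (a, b)" by (cases p)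
    have "c a b * ?d a b = 0"
    proof (rule ccontr)
      assume "c a b * ?d a b \<noteq> 0"
      then show False using delta_pairs p ab by blast
    qed
    then show "?f p = 0" by (simp add: ab)
  qed auto
  also have "\<dots> = sum ?f ?A + sum ?f ?B"
    using fin \<open>?A \<inter> ?B = {}\<close> by (simp add: sum.union_disjoint)
  also have "sum ?f ?A = (\<Sum>y\<in>?N. c x y * increment u x y)"
    by (subst sum.reindex)
      (auto simp: inj_on_def no_loops indicator_def intro!: sum.cong)
  also have "sum ?f ?B = (\<Sum>y\<in>?N. c x y * increment u x y)"
  proof (subst sum.reindex)
    show "inj_on (\<lambda>y. (y, x)) ?N" by (simp add: inj_on_def)
    have "c y x * ?d y x * increment u y x = c x y * increment u x y" if "y \<in> ?N" for y
    proof -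
      have "y \<noteq> x" using that no_loops by auto
      moreover have "increment u y x = - increment u x y"
        by transfer simp
      ultimately show ?thesis by (simp add: conductance_sym[of y x])
    qed
    then show "sum (?f \<circ> (\<lambda>y. (y, x))) ?N = (\<Sum>y\<in>?N. c x y * increment u x y)"
      by (intro sum.cong) simp_all
  qed
  finally show ?thesis
    unfolding energy_inner_increment increment_mod_const laplacian_mod_increment by simp
qed

lemma energy_class_in_energy_space: "a \<in> D \<Longrightarrow> energy_class a \<in> H"
proof -
  have "D \<subseteq> energy_class -` H"
    by (intro span_minimal linear_subspace_vimage linear_energy_class subspace_energy_space)
      (auto simp: ell2_delta.rep_eq delta_in_energy_space)
  then show "a \<in> D \<Longrightarrow> energy_class a \<in> H" by blast
qed

text \<open>Summation by parts: paired with a finitely supported function, the energy form is the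
  \<open>\<ell>\<^sup>2\<close> pairing with the Laplacian.\<close>

lemma energy_inner_energy_class:
  assumes "a \<in> D" "u \<in> H" and b: "ell2_fun b = laplacian_mod c u"
  shows "energy_inner c (energy_class a) u = inner a b"
proof -
  interpret L: linear energy_class by (rule linear_energy_class)
  let ?S = "{a. energy_class a \<in> H \<and> inner (gradient c (energy_class a)) (gradient c u) = inner a b}"
  have "subspace ?S"
    by (rule subspaceI)
      (auto simp only: mem_Collect_eq L.zero L.add L.scale energy_space_zero energy_space_add
        energy_space_scaleR gradient_zero gradient_add gradient_scaleR
        inner_zero_left inner_add_left inner_scaleR_left)
  moreover have "ell2_delta x \<in> ?S" for x
    using energy_inner_delta[of x u] assms(2) delta_in_energy_space[of x]
    by (simp add: ell2_delta.rep_eq energy_inner_eq_inner inner_ell2_delta_left b)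
  ultimately have "D \<subseteq> ?S" by (intro span_minimal) auto
  then show ?thesis using assms by (auto simp: energy_inner_eq_inner)
qed


section \<open>Reproducing kernels and monopoles\<close>

text \<open>A bounded functional on the energy space, here given by a vector \<open>p\<close> that need not be a
  gradient, is represented on \<open>S\<close> by the projection of \<open>p\<close>.\<close>

lemma energy_projection_exists:
  assumes "subspace S" "S \<subseteq> H" "complete (gradient c ` S)"
  obtains u where "u \<in> S"
    "\<And>z. z \<in> S \<Longrightarrow> inner (gradient c u) (gradient c z) = inner p (gradient c z)"
proof -
  obtain s where s: "s \<in> gradient c ` S" "\<And>g. g \<in> gradient c ` S \<Longrightarrow> inner (p - s) g = 0"
    using orthogonal_projection_exists[OF subspace_gradient[OF assms(1,2)] assms(3)] by metis
  then obtain u where "u \<in> S" "s = gradient c u" by blast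
  moreover have "inner s (gradient c z) = inner p (gradient c z)" if "z \<in> S" for z
    using s(2)[of "gradient c z"] that by (simp add: inner_diff_left)
  ultimately show thesis using that by blast
qed

lemma energy_orthogonal_imp_zero:
  assumes "u \<in> H" "inner (gradient c u) (gradient c u) = 0"
  shows "u = 0"
  using assms gradient_inj[OF assms(1) energy_space_zero] by (simp add: gradient_zero)

lemma energy_kernel:
  shows energy_kernel_in_energy_space: "energy_kernel c r x \<in> H"
    and energy_inner_energy_kernel:
      "u \<in> H \<Longrightarrow> energy_inner c (energy_kernel c r x) u = increment u x r"
proof -
  let ?P = "\<lambda>v. v \<in> H \<and> (\<forall>u\<in>H. energy_inner c v u = increment u x r)"
  have "\<exists>!v. ?P v"
  proof (rule ex_ex1I)
    obtain p where p: "\<forall>u\<in>H. inner p (gradient c u) = increment u x r"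
      using increment_bounded_functional by blast
    obtain v where "v \<in> H"
      "\<And>z. z \<in> H \<Longrightarrow> inner (gradient c v) (gradient c z) = inner p (gradient c z)"
      using energy_projection_exists[OF subspace_energy_space order_refl complete_gradient] by blast
    then show "\<exists>v. ?P v" using p by (auto simp: energy_inner_eq_inner)
  next
    fix v w assume vw: "?P v" "?P w"
    then have "v - w \<in> H" by (simp add: energy_space_diff)
    moreover have "inner (gradient c (v - w)) (gradient c (v - w)) = 0"
    proof -
      have "inner (gradient c v) (gradient c (v - w)) = inner (gradient c w) (gradient c (v - w))"
        using vw \<open>v - w \<in> H\<close> by (metis energy_inner_eq_inner)
      then show ?thesis using vw by (simp add: gradient_diff inner_diff_left)
    qed
    ultimately have "v - w = 0" by (rule energy_orthogonal_imp_zero)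
    then show "v = w" by simp
  qed
  then have "?P (energy_kernel c r x)" unfolding energy_kernel_def by (rule theI')
  then show "energy_kernel c r x \<in> H"
    "u \<in> H \<Longrightarrow> energy_inner c (energy_kernel c r x) u = increment u x r" by auto
qed

lemma laplacian_energy_kernel:
  "laplacian_mod c (energy_kernel c r x) y = indicator {x} y - indicator {r} y"
proof -
  have "laplacian_mod c (energy_kernel c r x) y =
      energy_inner c (energy_kernel c r x) (mod_const (indicator {y}))"
    by (simp flip: energy_inner_delta add: energy_inner_eq_inner delta_in_energy_space
        energy_kernel_in_energy_space inner_commute)
  also have "\<dots> = indicator {y} x - indicator {y} r"
    by (simp add: energy_inner_energy_kernel delta_in_energy_space)
  finally show ?thesis by (simp add: indicator_def eq_commute)
qed

text \<open>Monopoles at \<open>r\<close> differ by finite-energy harmonic functions, so the minimal one is the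
  component of any of them orthogonal to the harmonic functions.\<close>

lemma minimal_monopole_is_monopole:
  assumes "is_monopole c r w"
  shows "is_monopole c r (minimal_monopole c r)"
proof -
  define S where "S = {u \<in> H. \<forall>x. laplacian_mod c u x = 0}"
  have "subspace S"
    unfolding S_def
    by (rule subspaceI) (auto simp: laplacian_mod_add laplacian_mod_scaleR laplacian_mod_zero
        energy_space_add energy_space_scaleR energy_space_zero)
  have "S \<subseteq> H" by (auto simp: S_def)
  let ?d = "\<lambda>x. gradient c (mod_const (indicator {x}))"
  have "inner (?d x) (gradient c u) = laplacian_mod c u x" if "u \<in> H" for u x
    using that by (simp flip: energy_inner_delta add: energy_inner_eq_inner delta_in_energy_space)
  then have "gradient c ` S = gradient c ` H \<inter> (\<Inter>x. {g. inner (?d x) g = 0})"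
    by (auto simp: S_def)
  moreover have "closed (\<Inter>x. {g. inner (?d x) g = 0})"
    by (intro closed_INT ballI closed_Collect_eq continuous_intros)
  ultimately have "complete (gradient c ` S)"
    using complete_gradient by (simp add: complete_Int_closed)
  then obtain h where h: "h \<in> S"
    "\<And>z. z \<in> S \<Longrightarrow> inner (gradient c h) (gradient c z) = inner (gradient c w) (gradient c z)"
    using energy_projection_exists[OF \<open>subspace S\<close> \<open>S \<subseteq> H\<close>] by blast
  define w0 where "w0 = w - h"
  have "w \<in> H" "h \<in> H" using assms h by (auto simp: is_monopole_def S_def)
  have w0: "is_monopole c r w0"
    using assms h(1) unfolding is_monopole_def w0_def S_def
    by (auto simp: fun_eq_iff laplacian_mod_diff energy_space_diff)
  then have "w0 \<in> H" by (simp add: is_monopole_def)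
  have pythagoras: "energy_inner c v v =
      energy_inner c w0 w0 + inner (gradient c (v - w0)) (gradient c (v - w0))"
    and diff_in: "v - w0 \<in> H"
    if "is_monopole c r v" for v
  proof -
    have v: "v \<in> H" using that by (simp add: is_monopole_def)
    then show *: "v - w0 \<in> H" using \<open>w0 \<in> H\<close> by (rule energy_space_diff)
    have "v - w0 \<in> S"
      using that w0 * by (simp add: S_def is_monopole_def laplacian_mod_diff)
    then have "inner (gradient c w0) (gradient c (v - w0)) = 0"
      using h(2) \<open>w \<in> H\<close> \<open>h \<in> H\<close> by (simp add: w0_def gradient_diff inner_diff_left)
    then show "energy_inner c v v =
        energy_inner c w0 w0 + inner (gradient c (v - w0)) (gradient c (v - w0))"
      using v \<open>w0 \<in> H\<close>
      by (simp add: energy_inner_eq_inner gradient_diff inner_diff_left inner_diff_right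
          inner_commute)
  qed
  let ?P = "\<lambda>w. is_monopole c r w \<and>
    (\<forall>w'. is_monopole c r w' \<longrightarrow> energy_inner c w w \<le> energy_inner c w' w')"
  have "?P w0"
  proof (intro conjI allI impI w0)
    fix v assume "is_monopole c r v"
    then show "energy_inner c w0 w0 \<le> energy_inner c v v"
      using pythagoras[of v] inner_ge_zero[of "gradient c (v - w0)"] by linarith
  qed
  moreover have "v = w0" if "?P v" for v
  proof -
    have v: "is_monopole c r v" and "energy_inner c v v \<le> energy_inner c w0 w0"
      using that w0 by blast+
    then have "inner (gradient c (v - w0)) (gradient c (v - w0)) = 0"
      using pythagoras[OF v] inner_ge_zero[of "gradient c (v - w0)"] by linarith
    then have "v - w0 = 0"
      by (rule energy_orthogonal_imp_zero[OF diff_in[OF v]])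
    then show ?thesis by simp
  qed
  ultimately have "?P (minimal_monopole c r)"
    unfolding minimal_monopole_def by (rule theI)
  then show ?thesis by blast
qed

end


section \<open>Transience and the existence of monopoles\<close>

text \<open>At a vertex without edges the walk stays put, and hence returns with probability one.\<close>

lemma transient_total_conductance_pos:
  assumes "network c" "transient c"
  shows "0 < (\<Sum>z | 0 < c x z. c x z)"
proof (rule ccontr)
  assume "\<not> ?thesis"
  moreover have "0 \<le> (\<Sum>z | 0 < c x z. c x z)" by (intro sum_nonneg) auto
  ultimately have "step_prob c x z = of_bool (x = z)" for z by (simp add: step_prob_def)
  then have "first_hit_prob c x n x = (if n = 0 then 1 else 0)" for n
    by (cases n) (auto intro: sum.neutral)
  then have "(\<Sum>n. first_hit_prob c x n x) = 1"
    using sums_single[of 0 "\<lambda>_. 1 :: real"] by (simp add: sums_unique[symmetric])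
  then show False using assms(2) unfolding transient_def by (metis less_irrefl)
qed

text \<open>On a transient network the probability \<open>h\<close> of ever visiting \<open>x\<close> has finite energy and
  its Laplacian is a positive multiple of \<open>\<delta>\<^sub>x\<close>. It is the limit of the probabilities
  \<open>h\<^sub>n\<close> of a visit before time \<open>n + 1\<close>, which are finitely supported by local finiteness. As
  \<open>\<Delta> h\<^sub>n \<le> 0\<close> off \<open>x\<close>, summation by parts bounds the energy of \<open>h\<^sub>n\<close> by the total
  conductance at \<open>x\<close>.\<close>

theorem transient_imp_monopole:
  assumes "network c" "transient c"
  shows "\<exists>w. is_monopole c x w"
proof -
  interpret network c by (rule assms(1))
  define \<pi> where "\<pi> y = (\<Sum>z | 0 < c y z. c y z)" for y
  have \<pi>_pos: "0 < \<pi> y" for y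
    unfolding \<pi>_def by (rule transient_total_conductance_pos[OF assms])
  have p_eq: "step_prob c y z = c y z / \<pi> y" for y z
    using \<pi>_pos[of y] by (simp add: step_prob_def \<pi>_def)
  have p_pos: "0 < step_prob c y z \<longleftrightarrow> 0 < c y z" for y z
    using \<pi>_pos[of y] by (simp add: p_eq zero_less_divide_iff)
  define f where "f = first_hit_prob c x"
  \<comment> \<open>From \<open>y\<close>, the vertex \<open>x\<close> is visited at one of the times \<open>1, \<dots>, n\<close> with probability
    \<open>F n y\<close>, and at one of the times \<open>0, \<dots>, n\<close> with probability \<open>h n y\<close>.\<close>
  define F where "F n y = (\<Sum>k<n. f k y)" for n y
  define h where "h n y = (if y = x then 1 else F n y)" for n y
  have f_nonneg: "0 \<le> f n y" for n y
    unfolding f_def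
  proof (induction n arbitrary: y)
    case 0
    then show ?case
      using conductance_nonneg[of y x] \<pi>_pos[of y] by (simp add: p_eq)
  next
    case (Suc n)
    then show ?case by (auto intro!: sum_nonneg)
  qed
  \<comment> \<open>Conditioning on the first step.\<close>
  have F_Suc: "F (Suc n) y = (\<Sum>z | 0 < c y z. c y z * h n z) / \<pi> y" for n y
  proof -
    let ?N = "{z. 0 < c y z}"
    have fin: "finite ?N" by (rule locally_finite)
    have h_off: "(\<Sum>z\<in>?N - {x}. step_prob c y z * h n z) = (\<Sum>k<n. f (Suc k) y)"
    proof -
      have "?N - {x} = {z. 0 < step_prob c y z \<and> z \<noteq> x}" by (auto simp: p_pos)
      then have "(\<Sum>k<n. f (Suc k) y) = (\<Sum>k<n. \<Sum>z\<in>?N - {x}. step_prob c y z * f k z)"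
        by (simp add: f_def)
      also have "\<dots> = (\<Sum>z\<in>?N - {x}. \<Sum>k<n. step_prob c y z * f k z)"
        by (rule sum.swap)
      also have "\<dots> = (\<Sum>z\<in>?N - {x}. step_prob c y z * h n z)"
        by (intro sum.cong) (auto simp: h_def F_def sum_distrib_left)
      finally show ?thesis by simp
    qed
    have "(\<Sum>z\<in>?N. step_prob c y z * h n z) =
        step_prob c y x + (\<Sum>z\<in>?N - {x}. step_prob c y z * h n z)"
    proof (cases "x \<in> ?N")
      case True
      then show ?thesis by (simp add: sum.remove[OF fin True] h_def)
    next
      case False
      then have "step_prob c y x = 0"
        using conductance_nonneg[of y x] by (auto simp: p_eq less_le)
      then show ?thesis using False by simp
    qed
    also have "\<dots> = F (Suc n) y"
      unfolding h_off F_def sum.lessThan_Suc_shift by (simp add: f_def)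
    finally show ?thesis
      by (simp add: p_eq sum_divide_distrib)
  qed
  have F_bounds: "0 \<le> F n y" "F n y \<le> 1" for n y
  proof -
    show "0 \<le> F n y" unfolding F_def by (intro sum_nonneg f_nonneg)
    show "F n y \<le> 1"
    proof (induction n arbitrary: y)
      case (Suc n)
      have "(\<Sum>z | 0 < c y z. c y z * h n z) \<le> (\<Sum>z | 0 < c y z. c y z * 1)"
        using Suc by (intro sum_mono mult_left_mono) (auto simp: h_def)
      then show ?case using \<pi>_pos[of y] by (simp add: F_Suc \<pi>_def)
    qed (simp add: F_def)
  qed
  have lap_h: "laplacian c (h n) y = \<pi> y * (h n y - F (Suc n) y)" for n y
  proof -
    have "laplacian c (h n) y = \<pi> y * h n y - (\<Sum>z | 0 < c y z. c y z * h n z)"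
      unfolding laplacian_def \<pi>_def
      by (simp add: right_diff_distrib sum_subtractf sum_distrib_right)
    also have "\<dots> = \<pi> y * (h n y - F (Suc n) y)"
      using \<pi>_pos[of y] by (simp add: F_Suc right_diff_distrib)
    finally show ?thesis .
  qed

  \<comment> \<open>The energies of the \<open>h\<^sub>n\<close> are bounded.\<close>
  have f_supp: "finite {y. f n y \<noteq> 0}" for n
  proof (induction n)
    case 0
    have "{y. f 0 y \<noteq> 0} \<subseteq> {y. 0 < c x y}"
    proof
      fix y assume "y \<in> {y. f 0 y \<noteq> 0}"
      then have "c y x \<noteq> 0" by (auto simp: f_def p_eq)
      then show "y \<in> {y. 0 < c x y}"
        using conductance_nonneg[of x y] conductance_sym[of x y] by simp
    qed
    then show ?case using locally_finite finite_subset by blast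
  next
    case (Suc n)
    have "{y. f (Suc n) y \<noteq> 0} \<subseteq> (\<Union>z\<in>{z. f n z \<noteq> 0}. {y. 0 < c z y})"
    proof
      fix y assume "y \<in> {y. f (Suc n) y \<noteq> 0}"
      then have "(\<Sum>z | 0 < step_prob c y z \<and> z \<noteq> x. step_prob c y z * f n z) \<noteq> 0"
        by (simp add: f_def)
      then obtain z where "0 < c y z" "f n z \<noteq> 0"
        by (rule sum.not_neutral_contains_not_neutral) (auto simp: p_pos)
      then show "y \<in> (\<Union>z\<in>{z. f n z \<noteq> 0}. {y. 0 < c z y})"
        using conductance_sym[of y z] by auto
    qed
    then show ?case using locally_finite Suc by (auto intro: finite_subset)
  qed
  have h_supp: "finite {y. h n y \<noteq> 0}" for n
  proof (rule finite_subset)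
    show "finite (insert x (\<Union>k<n. {y. f k y \<noteq> 0}))" using f_supp by simp
    show "{y. h n y \<noteq> 0} \<subseteq> insert x (\<Union>k<n. {y. f k y \<noteq> 0})"
    proof clarify
      fix y assume "h n y \<noteq> 0" "y \<notin> (\<Union>k<n. {y. f k y \<noteq> 0})"
      then show "y = x" by (auto simp: h_def F_def split: if_splits)
    qed
  qed
  have h_energy: "mod_const (h n) \<in> H" "energy_norm c (mod_const (h n)) \<le> sqrt (\<pi> x)" for n
  proof -
    obtain a where a: "a \<in> D" "ell2_fun a = h n"
      using finite_support_in_span_delta[OF h_supp] by blast
    obtain b where b: "ell2_fun b = laplacian c (h n)"
      using laplacian_span_delta[OF a(1)] a(2) by metis
    show in_H: "mod_const (h n) \<in> H" using energy_class_in_energy_space[OF a(1)] a(2) by simp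
    have "0 \<le> inner a (\<pi> x *\<^sub>R ell2_delta x - b)"
      unfolding inner_ell2.rep_eq
    proof (intro infsum_nonneg mult_nonneg_nonneg)
      fix y
      show "0 \<le> ell2_fun a y" using F_bounds by (simp add: a(2) h_def)
      have "laplacian c (h n) y \<le> \<pi> x * indicator {x} y"
      proof (cases "y = x")
        case True
        have "\<pi> x * (1 - F (Suc n) x) \<le> \<pi> x * 1"
          using F_bounds \<pi>_pos[of x] by (intro mult_left_mono) auto
        then show ?thesis using True by (simp add: lap_h h_def)
      next
        case False
        have "F n y \<le> F (Suc n) y" by (simp add: F_def f_nonneg)
        then have "\<pi> y * (F n y - F (Suc n) y) \<le> 0"
          using \<pi>_pos[of y] by (intro mult_nonneg_nonpos) auto
        then show ?thesis using False by (simp add: lap_h h_def)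
      qed
      then show "0 \<le> ell2_fun (\<pi> x *\<^sub>R ell2_delta x - b) y"
        by (simp add: minus_ell2.rep_eq scaleR_ell2.rep_eq ell2_delta.rep_eq b)
    qed
    then have "inner a b \<le> \<pi> x * inner (ell2_delta x) a"
      by (simp add: inner_diff_right inner_commute)
    also have "\<dots> = \<pi> x" by (simp add: inner_ell2_delta_left a(2) h_def)
    finally have "inner a b \<le> \<pi> x" .
    moreover have "energy_inner c (mod_const (h n)) (mod_const (h n)) = inner a b"
      using energy_inner_energy_class[OF a(1) in_H, of b] a(2) b
      by (simp add: laplacian_mod.abs_eq)
    ultimately show "energy_norm c (mod_const (h n)) \<le> sqrt (\<pi> x)"
      by (simp add: energy_norm_def)
  qed

  have f_summable: "summable (\<lambda>n. f n y)" for y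
    using F_bounds[of _ y] f_nonneg[of _ y] unfolding F_def
    by (intro summableI_nonneg_bounded[where x = 1])
  define F' where "F' y = (\<Sum>n. f n y)" for y
  have F_lim: "(\<lambda>n. F n y) \<longlonglongrightarrow> F' y" for y
    unfolding F_def F'_def by (intro summable_LIMSEQ f_summable)
  define h' where "h' y = (if y = x then 1 else F' y)" for y
  have h_lim: "(\<lambda>n. h n y) \<longlonglongrightarrow> h' y" for y
    using F_lim[of y] by (simp add: h_def h'_def)
  have "mod_const h' \<in> H"
  proof (rule energy_norm_limit_le(1))
    show "(\<lambda>n. increment (mod_const (h n)) y z) \<longlonglongrightarrow> increment (mod_const h') y z" for y z
      unfolding increment_mod_const by (intro tendsto_intros h_lim)
    show "\<forall>\<^sub>F n in sequentially. energy_norm c (mod_const (h n)) \<le> sqrt (\<pi> x)"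
      using h_energy(2) by simp
  qed (rule h_energy(1))
  have "F' x < 1" using assms(2) unfolding transient_def F'_def f_def by blast
  define k where "k = \<pi> x * (1 - F' x)"
  have "0 < k" using \<open>F' x < 1\<close> \<pi>_pos[of x] by (simp add: k_def)
  have lap_h': "laplacian c h' y = k * indicator {x} y" for y
  proof -
    have "(\<lambda>n. laplacian c (h n) y) \<longlonglongrightarrow> laplacian c h' y"
      unfolding laplacian_def by (intro tendsto_intros h_lim)
    moreover have "(\<lambda>n. laplacian c (h n) y) \<longlonglongrightarrow> \<pi> y * (h' y - F' y)"
      unfolding lap_h by (intro tendsto_intros h_lim LIMSEQ_Suc F_lim)
    ultimately have "laplacian c h' y = \<pi> y * (h' y - F' y)" by (rule LIMSEQ_unique)
    then show ?thesis by (simp add: h'_def k_def)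
  qed
  have "laplacian_mod c ((1 / k) *\<^sub>R mod_const h') y = indicator {x} y" for y
    using \<open>0 < k\<close> by (simp add: laplacian_mod_scaleR laplacian_mod.abs_eq lap_h')
  then have "is_monopole c x ((1 / k) *\<^sub>R mod_const h')"
    unfolding is_monopole_def using energy_space_scaleR[OF \<open>mod_const h' \<in> H\<close>] by auto
  then show ?thesis by blast
qed

context network
begin

lemma monopole:
  assumes "transient c"
  shows monopole_in_energy_space: "monopole c r x \<in> H"
    and laplacian_monopole: "laplacian_mod c (monopole c r x) y = indicator {x} y"
proof -
  obtain w where "is_monopole c r w"
    using transient_imp_monopole[OF network_axioms assms] by blast
  then have "is_monopole c r (minimal_monopole c r)"
    by (rule minimal_monopole_is_monopole)
  then show "monopole c r x \<in> H" "laplacian_mod c (monopole c r x) y = indicator {x} y"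
    by (auto simp: is_monopole_def monopole_def energy_space_add energy_kernel_in_energy_space
        laplacian_mod_add laplacian_energy_kernel)
qed

lemma span_monopole:
  assumes "transient c" "w \<in> span (range (monopole c r))"
  shows span_monopole_in_energy_space: "w \<in> H"
    and laplacian_span_monopole: "\<exists>a\<in>D. ell2_fun a = laplacian_mod c w"
proof -
  let ?S = "{w \<in> H. \<exists>a\<in>D. ell2_fun a = laplacian_mod c w}"
  have "subspace ?S"
  proof (rule subspaceI; clarsimp)
    show "0 \<in> H \<and> (\<exists>a\<in>D. ell2_fun a = laplacian_mod c 0)"
      by (auto simp: energy_space_zero zero_ell2.rep_eq laplacian_mod_zero fun_eq_iff span_zero
          intro!: bexI[of _ 0])
  next
    fix u v and a b :: "'v ell2"
    assume *: "u \<in> H" "v \<in> H" "a \<in> D" "b \<in> D"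
      "ell2_fun a = laplacian_mod c u" "ell2_fun b = laplacian_mod c v"
    then show "u + v \<in> H \<and> (\<exists>a\<in>D. ell2_fun a = laplacian_mod c (u + v))"
      by (auto simp: energy_space_add plus_ell2.rep_eq laplacian_mod_add fun_eq_iff span_add
          intro!: bexI[of _ "a + b"])
  next
    fix k u and a :: "'v ell2"
    assume *: "u \<in> H" "a \<in> D" "ell2_fun a = laplacian_mod c u"
    then show "k *\<^sub>R u \<in> H \<and> (\<exists>a\<in>D. ell2_fun a = laplacian_mod c (k *\<^sub>R u))"
      by (auto simp: energy_space_scaleR scaleR_ell2.rep_eq laplacian_mod_scaleR fun_eq_iff
          span_scale intro!: bexI[of _ "k *\<^sub>R a"])
  qed
  moreover have "monopole c r x \<in> ?S" for x
  proof -
    have "ell2_fun (ell2_delta x) = laplacian_mod c (monopole c r x)"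
      by (simp add: fun_eq_iff ell2_delta.rep_eq laplacian_monopole[OF assms(1)])
    then show ?thesis
      using monopole_in_energy_space[OF assms(1)] by (auto intro: span_base)
  qed
  ultimately have "span (range (monopole c r)) \<subseteq> ?S" by (intro span_minimal) auto
  then show "w \<in> H" "\<exists>a\<in>D. ell2_fun a = laplacian_mod c w" using assms(2) by auto
qed

text \<open>The span of the monopoles contains the reproducing kernels, and only constants are
  orthogonal to all of these.\<close>

lemma span_monopole_dense:
  assumes "transient c"
  shows "gradient c ` H \<subseteq> closure (gradient c ` span (range (monopole c r)))"
proof
  let ?M = "span (range (monopole c r))"
  let ?C = "closure (gradient c ` ?M)"
  define S where "S = {u \<in> H. gradient c u \<in> ?C}"
  have M_H: "?M \<subseteq> H" using span_monopole_in_energy_space[OF assms] by blast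
  have M_S: "?M \<subseteq> S" using M_H closure_subset[of "gradient c ` ?M"] by (auto simp: S_def)
  have sub_C: "subspace ?C"
    by (intro subspace_closure subspace_gradient M_H subspace_span)
  have "S \<subseteq> H" by (simp add: S_def)
  have "subspace S"
    unfolding S_def
    by (rule subspaceI) (auto simp: energy_space_zero gradient_zero energy_space_add gradient_add
        energy_space_scaleR gradient_scaleR subspace_0[OF sub_C] subspace_add[OF sub_C]
        subspace_scale[OF sub_C])
  have "gradient c ` S = gradient c ` H \<inter> ?C" by (auto simp: S_def)
  then have "complete (gradient c ` S)"
    using complete_gradient by (simp add: complete_Int_closed)
  fix g assume "g \<in> gradient c ` H"
  then obtain u where u: "u \<in> H" "g = gradient c u" by blast
  obtain s where s: "s \<in> S"
    "\<And>z. z \<in> S \<Longrightarrow> inner (gradient c s) (gradient c z) = inner g (gradient c z)"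
    using energy_projection_exists[OF \<open>subspace S\<close> \<open>S \<subseteq> H\<close> \<open>complete (gradient c ` S)\<close>] by blast
  have "s \<in> H" using s(1) by (simp add: S_def)
  have "increment u x r = increment s x r" for x
  proof (cases "x = r")
    case True
    then show ?thesis using increment_split[of _ r r r] by simp
  next
    case False
    have "monopole c r x - monopole c r r \<in> ?M" by (intro span_diff span_base rangeI)
    then have "energy_kernel c r x \<in> S" using M_S False by (auto simp: monopole_def)
    then have "inner (gradient c (energy_kernel c r x)) (gradient c s) =
        inner (gradient c (energy_kernel c r x)) g"
      using s(2) by (metis inner_commute)
    then show ?thesis
      using energy_inner_energy_kernel[OF u(1), of r x] energy_inner_energy_kernel[OF \<open>s \<in> H\<close>, of r x]
      by (simp add: energy_inner_eq_inner energy_kernel_in_energy_space u \<open>s \<in> H\<close>)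
  qed
  then have "u = s" by (rule mod_const_eqI)
  then show "g \<in> ?C" using s(1) u(2) by (simp add: S_def)
qed


section \<open>The energy topology\<close>

lemma energy_norm_nonneg: "0 \<le> energy_norm c u"
proof -
  have "0 \<le> c x y * increment u x y * increment u x y" for x y
    using conductance_nonneg[of x y] by (simp add: mult.assoc)
  then show ?thesis
    unfolding energy_norm_def energy_inner_increment by (auto intro!: infsum_nonneg)
qed

lemma energy_Metric_space: "Metric_space H (\<lambda>u v. energy_norm c (u - v))"
proof
  fix u v :: "'v mod_const"
  have "c x y * increment (u - v) x y * increment (u - v) x y =
      c x y * increment (v - u) x y * increment (v - u) x y" for x y
    by (simp add: algebra_simps)
  then show "energy_norm c (u - v) = energy_norm c (v - u)"
    unfolding energy_norm_def energy_inner_increment by (simp only:)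
next
  fix u v w assume "u \<in> H" "v \<in> H" "w \<in> H"
  then show "energy_norm c (u - w) \<le> energy_norm c (u - v) + energy_norm c (v - w)"
    using norm_triangle_ineq[of "gradient c u - gradient c v" "gradient c v - gradient c w"]
    by (simp add: energy_norm_eq_norm energy_space_diff gradient_diff)
next
  fix u v assume "u \<in> H" "v \<in> H"
  then show "energy_norm c (u - v) = 0 \<longleftrightarrow> u = v"
    by (auto simp: energy_norm_eq_norm energy_space_diff gradient_diff intro: gradient_inj)
qed (rule energy_norm_nonneg)

lemma topspace_energy_topology: "topspace (energy_topology c) = H"
  unfolding energy_topology_def by (rule Metric_space.topspace_mtopology[OF energy_Metric_space])

lemma energy_neighbourhood:
  assumes "u \<in> H" "0 < e"
  obtains U where "openin (energy_topology c) U" "u \<in> U"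
    "\<And>u'. u' \<in> U \<Longrightarrow> \<bar>energy_norm c u - energy_norm c u'\<bar> < e"
proof -
  interpret E: Metric_space H "\<lambda>u v. energy_norm c (u - v)" by (rule energy_Metric_space)
  have "\<bar>energy_norm c u - energy_norm c u'\<bar> < e" if "u' \<in> E.mball u e" for u'
  proof -
    have "u' \<in> H" "energy_norm c (u - u') < e" using that by auto
    then show ?thesis
      using norm_triangle_ineq3[of "gradient c u" "gradient c u'"] assms(1)
      by (simp add: energy_norm_eq_norm energy_space_diff gradient_diff)
  qed
  moreover have "u \<in> E.mball u e" using assms by (simp only: E.centre_in_mball_iff)
  moreover have "openin (energy_topology c) (E.mball u e)"
    unfolding energy_topology_def by (rule E.openin_mball)
  ultimately show thesis using that by blast
qed


section \<open>Bounds of the three operators\<close>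

lemma ell2_laplacian_bound_iff:
  assumes "0 \<le> K"
  shows "(\<forall>(u, v)\<in>ell2_laplacian c. norm v \<le> K * norm u) \<longleftrightarrow>
    (\<forall>a\<in>D. \<forall>b. ell2_fun b = laplacian c (ell2_fun a) \<longrightarrow> norm b \<le> K * norm a)"
proof -
  let ?T = "{(u, v). u \<in> D \<and> ell2_fun v = laplacian c (ell2_fun u)}"
  have "\<exists>(u', v')\<in>?T. \<bar>norm u - norm u'\<bar> < e \<and> \<bar>norm v - norm v'\<bar> < e"
    if uv: "(u, v) \<in> ell2_laplacian c" "0 < e" for u v and e :: real
  proof -
    obtain p where p: "p \<in> ?T" "dist p (u, v) < e"
      using uv unfolding ell2_laplacian_def closure_approachable by blast
    have "dist (fst p) u < e" "dist (snd p) v < e"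
      using p(2) dist_fst_le[of p "(u, v)"] dist_snd_le[of p "(u, v)"] by simp_all
    then have "\<bar>norm u - norm (fst p)\<bar> < e" "\<bar>norm v - norm (snd p)\<bar> < e"
      using norm_triangle_ineq3[of u "fst p"] norm_triangle_ineq3[of v "snd p"]
      by (simp_all add: dist_norm norm_minus_commute)
    then show ?thesis using p(1) by (intro bexI[of _ p]) (auto simp: split_beta)
  qed
  then have "(\<forall>(u, v)\<in>ell2_laplacian c. norm v \<le> K * norm u) \<longleftrightarrow>
      (\<forall>(u, v)\<in>?T. norm v \<le> K * norm u)"
    using assms closure_subset[of ?T] by (intro graph_bound_approx) (auto simp: ell2_laplacian_def)
  then show ?thesis by auto
qed

lemma energy_laplacian_bound_iff:
  assumes "transient c" "0 \<le> K"
  shows "(\<forall>(u, v)\<in>energy_laplacian c r. energy_norm c v \<le> K * energy_norm c u) \<longleftrightarrow>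
    (\<forall>w\<in>span (range (monopole c r)).
      energy_norm c (mod_const (laplacian_mod c w)) \<le> K * energy_norm c w)"
proof -
  let ?T = "{(u, v). u \<in> span (range (monopole c r)) \<and> v = mod_const (laplacian_mod c u)}"
  let ?X = "prod_topology (energy_topology c) (energy_topology c)"
  have "mod_const (laplacian_mod c w) \<in> H" if "w \<in> span (range (monopole c r))" for w
    using laplacian_span_monopole[OF assms(1) that] energy_class_in_energy_space by metis
  then have "?T \<subseteq> topspace ?X"
    using span_monopole_in_energy_space[OF assms(1)] by (auto simp: topspace_energy_topology)
  then have "?T \<subseteq> energy_laplacian c r"
    unfolding energy_laplacian_def by (rule closure_of_subset)
  moreover have "\<exists>(u', v')\<in>?T.
      \<bar>energy_norm c u - energy_norm c u'\<bar> < e \<and> \<bar>energy_norm c v - energy_norm c v'\<bar> < e"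
    if uv: "(u, v) \<in> energy_laplacian c r" "0 < e" for u v and e :: real
  proof -
    have cl: "(u, v) \<in> ?X closure_of ?T" using uv(1) by (simp add: energy_laplacian_def)
    then have "(u, v) \<in> topspace ?X" by (simp only: in_closure_of)
    then have "u \<in> H" "v \<in> H" by (simp_all add: topspace_energy_topology)
    obtain U where U: "openin (energy_topology c) U" "u \<in> U"
      "\<And>u'. u' \<in> U \<Longrightarrow> \<bar>energy_norm c u - energy_norm c u'\<bar> < e"
      using energy_neighbourhood[OF \<open>u \<in> H\<close> uv(2)] by blast
    obtain V where V: "openin (energy_topology c) V" "v \<in> V"
      "\<And>v'. v' \<in> V \<Longrightarrow> \<bar>energy_norm c v - energy_norm c v'\<bar> < e"
      using energy_neighbourhood[OF \<open>v \<in> H\<close> uv(2)] by blast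
    show ?thesis
      using closure_of_prod_topologyD[OF cl U(1,2) V(1,2)] U(3) V(3) by fast
  qed
  ultimately have "(\<forall>(u, v)\<in>energy_laplacian c r. energy_norm c v \<le> K * energy_norm c u) \<longleftrightarrow>
      (\<forall>(u, v)\<in>?T. energy_norm c v \<le> K * energy_norm c u)"
    by (intro graph_bound_approx[OF assms(2)])
  then show ?thesis by auto
qed

lemma inclusion_operator_bound_iff:
  assumes "0 \<le> K"
  shows "(\<forall>(u, v)\<in>inclusion_operator c. energy_norm c v \<le> K * norm u) \<longleftrightarrow>
    (\<forall>a\<in>D. energy_norm c (energy_class a) \<le> K * norm a)"
proof -
  let ?T = "{(u, v). u \<in> D \<and> v = energy_class u}"
  let ?X = "prod_topology euclidean (energy_topology c)"
  have "?T \<subseteq> topspace ?X"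
    using energy_class_in_energy_space by (auto simp: topspace_energy_topology)
  then have "?T \<subseteq> inclusion_operator c"
    unfolding inclusion_operator_def by (rule closure_of_subset)
  moreover have "\<exists>(u', v')\<in>?T.
      \<bar>norm u - norm u'\<bar> < e \<and> \<bar>energy_norm c v - energy_norm c v'\<bar> < e"
    if uv: "(u, v) \<in> inclusion_operator c" "0 < e" for u v and e :: real
  proof -
    have cl: "(u, v) \<in> ?X closure_of ?T" using uv(1) by (simp add: inclusion_operator_def)
    then have "(u, v) \<in> topspace ?X" by (simp only: in_closure_of)
    then have "v \<in> H" by (simp add: topspace_energy_topology)
    have U: "\<bar>norm u - norm u'\<bar> < e" if "u' \<in> ball u e" for u'
      using norm_triangle_ineq3[of u u'] that by (simp add: dist_norm)
    obtain V where V: "openin (energy_topology c) V" "v \<in> V"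
      "\<And>v'. v' \<in> V \<Longrightarrow> \<bar>energy_norm c v - energy_norm c v'\<bar> < e"
      using energy_neighbourhood[OF \<open>v \<in> H\<close> uv(2)] by blast
    have "openin euclidean (ball u e)" "u \<in> ball u e" using uv(2) by simp_all
    from closure_of_prod_topologyD[OF cl this V(1,2)] U V(3) show ?thesis by fast
  qed
  ultimately have "(\<forall>(u, v)\<in>inclusion_operator c. energy_norm c v \<le> K * norm u) \<longleftrightarrow>
      (\<forall>(u, v)\<in>?T. energy_norm c v \<le> K * norm u)"
    by (intro graph_bound_approx[OF assms])
  then show ?thesis by auto
qed

lemma energy_Cauchy_Schwarz:
  "u \<in> H \<Longrightarrow> v \<in> H \<Longrightarrow> energy_inner c u v \<le> energy_norm c u * energy_norm c v"
  by (simp add: energy_inner_eq_inner energy_norm_eq_norm norm_cauchy_schwarz)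

theorem ell2_laplacian_bound_iff_inclusion_bound:
  assumes "0 \<le> K"
  shows "(\<forall>(u, v)\<in>ell2_laplacian c. norm v \<le> K * norm u) \<longleftrightarrow>
    (\<forall>(u, v)\<in>inclusion_operator c. energy_norm c v \<le> sqrt K * norm u)"
proof -
  have "(\<forall>a\<in>D. \<forall>b. ell2_fun b = laplacian c (ell2_fun a) \<longrightarrow> norm b \<le> K * norm a) \<longleftrightarrow>
    (\<forall>a\<in>D. energy_norm c (energy_class a) \<le> sqrt K * norm a)" (is "?L \<longleftrightarrow> ?R")
  proof
    assume L: ?L
    show ?R
    proof
      fix a assume a: "a \<in> D"
      then obtain b where b: "ell2_fun b = laplacian c (ell2_fun a)"
        using laplacian_span_delta by blast
      have "energy_inner c (energy_class a) (energy_class a) = inner a b"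
        using a b by (intro energy_inner_energy_class energy_class_in_energy_space)
          (simp_all add: laplacian_mod.abs_eq)
      also have "\<dots> \<le> norm a * norm b" by (rule norm_cauchy_schwarz)
      also have "\<dots> \<le> norm a * (K * norm a)"
        using L a b by (intro mult_left_mono) auto
      finally have "energy_norm c (energy_class a) \<le> sqrt (K * (norm a)\<^sup>2)"
        unfolding energy_norm_def by (simp add: power2_eq_square mult_ac)
      then show "energy_norm c (energy_class a) \<le> sqrt K * norm a"
        by (simp add: real_sqrt_mult)
    qed
  next
    assume R: ?R
    show ?L
    proof (intro ballI allI impI)
      fix a b assume a: "a \<in> D" and b: "ell2_fun b = laplacian c (ell2_fun a)"
      have "b \<in> D"
        using laplacian_span_delta[OF a] b by (metis ell2_fun_inject)
      have "norm b * norm b = inner b b"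
        by (simp flip: power2_norm_eq_inner add: power2_eq_square)
      also have "\<dots> = energy_inner c (energy_class b) (energy_class a)"
        using a b \<open>b \<in> D\<close>
        by (intro energy_inner_energy_class[symmetric] energy_class_in_energy_space)
          (simp_all add: laplacian_mod.abs_eq)
      also have "\<dots> \<le> energy_norm c (energy_class b) * energy_norm c (energy_class a)"
        using a \<open>b \<in> D\<close> by (intro energy_Cauchy_Schwarz energy_class_in_energy_space)
      also have "\<dots> \<le> (sqrt K * norm b) * (sqrt K * norm a)"
        using R a \<open>b \<in> D\<close> assms by (intro mult_mono) (auto simp: energy_norm_nonneg)
      also have "\<dots> = (sqrt K * sqrt K) * norm a * norm b" by (simp only: mult_ac)
      also have "\<dots> = (K * norm a) * norm b" using assms by simp
      finally show "norm b \<le> K * norm a"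
        using assms by (cases "b = 0") simp_all
    qed
  qed
  then show ?thesis
    using assms by (simp only: ell2_laplacian_bound_iff inclusion_operator_bound_iff
        real_sqrt_ge_zero)
qed

theorem energy_laplacian_bound_iff_inclusion_bound:
  assumes "transient c" "0 \<le> K"
  shows "(\<forall>(u, v)\<in>energy_laplacian c r. energy_norm c v \<le> K * energy_norm c u) \<longleftrightarrow>
    (\<forall>(u, v)\<in>inclusion_operator c. energy_norm c v \<le> sqrt K * norm u)"
proof -
  let ?M = "span (range (monopole c r))"
  have M: "w \<in> H \<and> (\<exists>a\<in>D. ell2_fun a = laplacian_mod c w)" if "w \<in> ?M" for w
    using span_monopole[OF assms(1) that] by blast
  have pairing: "inner a b = energy_inner c (energy_class a) w"
    if "a \<in> D" "w \<in> ?M" "ell2_fun b = laplacian_mod c w" for a b w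
    using energy_inner_energy_class that M by metis
  have "(\<forall>w\<in>?M. energy_norm c (mod_const (laplacian_mod c w)) \<le> K * energy_norm c w) \<longleftrightarrow>
    (\<forall>a\<in>D. energy_norm c (energy_class a) \<le> sqrt K * norm a)" (is "?L \<longleftrightarrow> ?R")
  proof
    assume R: ?R
    show ?L
    proof
      fix w assume w: "w \<in> ?M"
      then obtain a where a: "a \<in> D" "ell2_fun a = laplacian_mod c w" using M by blast
      let ?n = "energy_norm c (energy_class a)"
      have "?n * ?n \<le> (sqrt K * norm a) * (sqrt K * norm a)"
        using R a(1) assms(2) by (intro mult_mono) (auto simp: energy_norm_nonneg)
      also have "\<dots> = (sqrt K * sqrt K) * (norm a * norm a)" by (simp only: mult_ac)
      also have "\<dots> = K * inner a a"
        using assms(2) by (simp flip: power2_norm_eq_inner add: power2_eq_square)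
      also have "\<dots> = K * energy_inner c (energy_class a) w"
        using pairing[OF a(1) w a(2)] by simp
      also have "\<dots> \<le> K * (?n * energy_norm c w)"
        using assms(2) a(1) w M
        by (intro mult_left_mono energy_Cauchy_Schwarz energy_class_in_energy_space) blast+
      also have "\<dots> = (K * energy_norm c w) * ?n" by (simp only: mult_ac)
      finally have "?n \<le> K * energy_norm c w"
        using assms(2) energy_norm_nonneg[of w] energy_norm_nonneg[of "energy_class a"]
        by (cases "?n = 0") simp_all
      then show "energy_norm c (mod_const (laplacian_mod c w)) \<le> K * energy_norm c w"
        by (simp add: a(2))
    qed
  next
    assume L: ?L
    show ?R
    proof
      fix a assume a: "a \<in> D"
      let ?u = "energy_class a" and ?k = "sqrt K * norm a"
      have u: "?u \<in> H" using a by (rule energy_class_in_energy_space)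
      have on_M: "inner (gradient c ?u) (gradient c v) \<le> ?k * norm (gradient c v)"
        if v: "v \<in> ?M" for v
      proof -
        obtain b where b: "b \<in> D" "ell2_fun b = laplacian_mod c v" using M v by blast
        have "v \<in> H" using M v by blast
        have "(norm b)\<^sup>2 = energy_inner c (energy_class b) v"
          using pairing[OF b(1) v b(2)] by (simp add: power2_norm_eq_inner)
        also have "\<dots> \<le> energy_norm c (energy_class b) * energy_norm c v"
          using b(1) \<open>v \<in> H\<close> by (intro energy_Cauchy_Schwarz energy_class_in_energy_space)
        also have "\<dots> \<le> (K * energy_norm c v) * energy_norm c v"
          using L v b(2) by (intro mult_right_mono) (auto simp: energy_norm_nonneg)
        also have "\<dots> = (sqrt K * energy_norm c v)\<^sup>2"
          using assms(2) by (simp add: power_mult_distrib power2_eq_square)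
        finally have b_le: "norm b \<le> sqrt K * energy_norm c v"
          by (rule power2_le_imp_le) (simp add: assms(2) energy_norm_nonneg)
        have "energy_inner c ?u v = inner a b" using pairing[OF a v b(2)] by simp
        also have "\<dots> \<le> norm a * norm b" by (rule norm_cauchy_schwarz)
        also have "\<dots> \<le> norm a * (sqrt K * energy_norm c v)"
          using b_le by (rule mult_left_mono) simp
        finally show ?thesis
          using u \<open>v \<in> H\<close> by (simp add: energy_inner_eq_inner energy_norm_eq_norm mult_ac)
      qed
      \<comment> \<open>By density the estimate extends from \<open>v\<close> in the span of the monopoles to \<open>v = a\<close>.\<close>
      have "closed {g. inner (gradient c ?u) g \<le> ?k * norm g}"
        by (intro closed_Collect_le continuous_intros)
      then have "closure (gradient c ` ?M) \<subseteq> {g. inner (gradient c ?u) g \<le> ?k * norm g}"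
        using on_M by (intro closure_minimal) auto
      then have "inner (gradient c ?u) (gradient c ?u) \<le> ?k * norm (gradient c ?u)"
        using span_monopole_dense[OF assms(1)] u by blast
      then have "energy_norm c ?u * energy_norm c ?u \<le> ?k * energy_norm c ?u"
        using u by (simp add: energy_norm_eq_norm flip: power2_norm_eq_inner power2_eq_square)
      then show "energy_norm c ?u \<le> ?k"
        using assms(2) energy_norm_nonneg[of ?u] by (cases "energy_norm c ?u = 0") simp_all
    qed
  qed
  then show ?thesis
    using assms by (simp only: energy_laplacian_bound_iff inclusion_operator_bound_iff
        real_sqrt_ge_zero)
qed

lemma operators_nonempty:
  "ell2_laplacian c \<noteq> {}" "energy_laplacian c r \<noteq> {}" "inclusion_operator c \<noteq> {}"
proof -
  have "(0, 0) \<in> {(u :: 'v ell2, v). u \<in> D \<and> ell2_fun v = laplacian c (ell2_fun u)}"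
    by (simp add: zero_ell2.rep_eq laplacian_def fun_eq_iff span_zero)
  then show "ell2_laplacian c \<noteq> {}"
    unfolding ell2_laplacian_def using closure_subset by blast
  have zero: "mod_const (\<lambda>_. 0) = 0" by (simp add: zero_mod_const_def)
  have "laplacian_mod c 0 = (\<lambda>_. 0)" by (simp add: fun_eq_iff laplacian_mod_zero)
  then have "(0, 0) \<in> topspace (prod_topology (energy_topology c) (energy_topology c)) \<inter>
      {(u, v). u \<in> span (range (monopole c r)) \<and> v = mod_const (laplacian_mod c u)}"
    by (simp add: zero topspace_energy_topology energy_space_zero span_zero)
  then have "(0, 0) \<in> energy_laplacian c r"
    unfolding energy_laplacian_def by (rule subsetD[OF closure_of_subset_Int])
  then show "energy_laplacian c r \<noteq> {}" by blast
  have "(0, 0) \<in> topspace (prod_topology euclidean (energy_topology c)) \<inter>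
      {(u, v). u \<in> D \<and> v = energy_class u}"
    by (simp add: zero zero_ell2.rep_eq topspace_energy_topology energy_space_zero span_zero)
  then have "(0, 0) \<in> inclusion_operator c"
    unfolding inclusion_operator_def by (rule subsetD[OF closure_of_subset_Int])
  then show "inclusion_operator c \<noteq> {}" by blast
qed

end

theorem theorem3p20:
  fixes c :: "'v \<Rightarrow> 'v \<Rightarrow> real" and r :: 'v
  assumes "network c" and "transient c"
  shows
    "(bounded_operator norm norm (ell2_laplacian c) \<longleftrightarrow>
        bounded_operator (energy_norm c) (energy_norm c) (energy_laplacian c r)) \<and>
     (bounded_operator (energy_norm c) (energy_norm c) (energy_laplacian c r) \<longleftrightarrow>
        bounded_operator norm (energy_norm c) (inclusion_operator c)) \<and>
     (bounded_operator norm (energy_norm c) (inclusion_operator c) \<longrightarrow>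
        operator_norm norm norm (ell2_laplacian c) =
          operator_norm (energy_norm c) (energy_norm c) (energy_laplacian c r) \<and>
        operator_norm (energy_norm c) (energy_norm c) (energy_laplacian c r) =
          (operator_norm norm (energy_norm c) (inclusion_operator c))\<^sup>2)"
proof -
  interpret network c by (rule assms(1))
  define A where "A K \<longleftrightarrow> (\<forall>(u, v)\<in>ell2_laplacian c. norm v \<le> K * norm u)" for K
  define B where
    "B K \<longleftrightarrow> (\<forall>(u, v)\<in>energy_laplacian c r. energy_norm c v \<le> K * energy_norm c u)" for K
  define J where "J K \<longleftrightarrow> (\<forall>(u, v)\<in>inclusion_operator c. energy_norm c v \<le> K * norm u)" for K
  have AJ: "A K \<longleftrightarrow> J (sqrt K)" and BJ: "B K \<longleftrightarrow> J (sqrt K)" if "0 \<le> K" for K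
    unfolding A_def B_def J_def
    using ell2_laplacian_bound_iff_inclusion_bound[OF that]
      energy_laplacian_bound_iff_inclusion_bound[OF assms(2) that] by auto
  have bdd: "bounded_operator norm norm (ell2_laplacian c) \<longleftrightarrow> (\<exists>K\<ge>0. A K)"
    "bounded_operator (energy_norm c) (energy_norm c) (energy_laplacian c r) \<longleftrightarrow> (\<exists>K\<ge>0. B K)"
    "bounded_operator norm (energy_norm c) (inclusion_operator c) \<longleftrightarrow> (\<exists>K\<ge>0. J K)"
    unfolding A_def B_def J_def
    by (intro bounded_operator_iff_nonneg_bound norm_ge_zero energy_norm_nonneg)+
  have AB: "(\<exists>K\<ge>0. A K) \<longleftrightarrow> (\<exists>K\<ge>0. B K)" using AJ BJ by blast
  have BJ': "(\<exists>K\<ge>0. B K) \<longleftrightarrow> (\<exists>K\<ge>0. J K)"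
  proof
    assume "\<exists>K\<ge>0. J K"
    then obtain K where "0 \<le> K" "J K" by blast
    then have "B (K\<^sup>2)" by (simp add: BJ)
    then show "\<exists>K\<ge>0. B K" using zero_le_power2 by blast
  qed (use BJ real_sqrt_ge_zero in blast)
  let ?a = "operator_norm norm norm (ell2_laplacian c)"
    and ?b = "operator_norm (energy_norm c) (energy_norm c) (energy_laplacian c r)"
    and ?j = "operator_norm norm (energy_norm c) (inclusion_operator c)"
  have "?a = ?b \<and> ?b = ?j\<^sup>2" if "bounded_operator norm (energy_norm c) (inclusion_operator c)"
  proof -
    have bounded: "bounded_operator norm norm (ell2_laplacian c)"
      "bounded_operator (energy_norm c) (energy_norm c) (energy_laplacian c r)"
      "bounded_operator norm (energy_norm c) (inclusion_operator c)"
      using that AB BJ' by (simp_all add: bdd)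
    note pos = norm_ge_zero energy_norm_nonneg
    have le: "?a \<le> K \<longleftrightarrow> A K" "?b \<le> K \<longleftrightarrow> B K" "?j \<le> K \<longleftrightarrow> J K" if "0 \<le> K" for K
      unfolding A_def B_def J_def
      using operator_norm_le_iff[OF bounded(1) operators_nonempty(1) pos(1,1) that]
        operator_norm_le_iff[OF bounded(2) operators_nonempty(2) pos(2,2) that]
        operator_norm_le_iff[OF bounded(3) operators_nonempty(3) pos(1,2) that]
      by blast+
    have nonneg: "0 \<le> ?a" "0 \<le> ?b" "0 \<le> ?j"
      using operator_norm_nonneg[OF bounded(1) operators_nonempty(1) pos(1,1)]
        operator_norm_nonneg[OF bounded(2) operators_nonempty(2) pos(2,2)]
        operator_norm_nonneg[OF bounded(3) operators_nonempty(3) pos(1,2)]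
      by blast+
    have a_iff: "?a \<le> K \<longleftrightarrow> ?j\<^sup>2 \<le> K" and b_iff: "?b \<le> K \<longleftrightarrow> ?j\<^sup>2 \<le> K" if "0 \<le> K" for K
    proof -
      have "J (sqrt K) \<longleftrightarrow> ?j\<^sup>2 \<le> K"
        using le(3)[of "sqrt K"] that nonneg(3) by (simp flip: real_sqrt_le_iff[of "?j\<^sup>2"])
      then show "?a \<le> K \<longleftrightarrow> ?j\<^sup>2 \<le> K" "?b \<le> K \<longleftrightarrow> ?j\<^sup>2 \<le> K"
        using le(1,2) AJ BJ that by simp_all
    qed
    have "?a = ?j\<^sup>2" using a_iff[of ?a] a_iff[of "?j\<^sup>2"] nonneg by simp
    moreover have "?b = ?j\<^sup>2" using b_iff[of ?b] b_iff[of "?j\<^sup>2"] nonneg by simp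
    ultimately show ?thesis by simp
  qed
  then show ?thesis using AB BJ' by (simp only: bdd) blast
qed

end
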